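(* Fix integers $p\ge 0$, $q\ge 1$, $s\ge 1$ and an alphabet consisting of $p$ unary connectives $\diamond_1,\dots,\diamond_p$, $q$ binary connectives $\ast_1,\dots,\ast_q$ and $s$ primitive symbols $\clubsuit_1,\dots,\clubsuit_s$. Let $\mathcal F_n$ be the set of closed formulas over this alphabet with exactly $n$ connectives, put $$r=\frac{1}{p+2qs+2\sqrt{(p+qs)qs}},$$ and for a class $W$ of closed formulas with $\mathcal W_n=W\cap\mathcal F_n$ define $\lambda_W=\sum_{n\ge 0} r^{n+1}\,\#\mathcal W_n$ and $\mu_W=\lim_{n\to\infty}\#\mathcal W_n/\#\mathcal F_n$ (when this limit exists; "$\mu_W$ exists" means the limit exists). (a) Suppose $W$ is given by the productions $W::=U\mid V$, where $U,V$ are classes with $\mathcal U_n\cap\mathcal V_n=\emptyset$ for every $n$. If $\mu_U$ and $\mu_V$ exist, then $\mu_W$ exists and $\lambda_W=\lambda_U+\lambda_V$, $\mu_W=\mu_U+\mu_V$. (b) Suppose $W$ is given by the productions $$W::=U\mid \diamond_1 W\mid\cdots\mid\diamond_{p'}W\mid W\ast_1 W\mid\cdots\mid W\ast_{q'}W\mid (V\setminus W)\ast_1 W\mid\cdots\mid (V\setminus W)\ast_{q''}W,$$ where $p',q',q''$ are integers with $0\le p'\le p$, $0\le q'\le q$, $0\le q''\le q$, $(p',q',q'')\ne(p,q,0)$, and $U,V$ are classes of formulas such that $\mathcal U_n$ contains no other formula of complexity $n$ arising from the other productions on the right-hand side, $\mathcal U_0$ contains at least one primitive symbol, and $\mathcal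 W_n\subseteq\mathcal V_n$ for all $n$. If $\mu_U$ and $\mu_V$ exist, then $\mu_W$ exists and $$\lambda_W=\frac{2\lambda_U}{1-p'r-q''\lambda_V+\sqrt{(1-p'r-q''\lambda_V)^2-4(q'-q'')\lambda_U}},\qquad \mu_W=\frac{\mu_U+q''\lambda_W\mu_V}{1-p'r-q''\lambda_V-2(q'-q'')\lambda_W}.$$ (c) Suppose $W$ is given by the productions $$W::=\clubsuit_1\mid\cdots\mid\clubsuit_{s'}\mid\diamond_1T\mid\cdots\mid\diamond_{p'}T\mid U\ast_1V\mid\cdots\mid U\ast_{q'}V,$$ where $0\le p'\le p$, $0\le q'\le q$, $0\le s'\le s$ are integers and $T,U,V$ are classes of formulas. If $\mu_T,\mu_U,\mu_V$ exist, then $\mu_W$ exists and $$\lambda_W=rs'+p'r\lambda_T+q'\lambda_U\lambda_V,\qquad \mu_W=p'r\mu_T+q'\lambda_V\mu_U+q'\lambda_U\mu_V.$$ (d) Suppose $W$ is given by the productions $$W::=U\mid\diamond_1W\mid\cdots\mid\diamond_{p'}W\mid \clubsuit_1\ast_1(\diamond_1W)\mid\cdots\mid\clubsuit_{q'}\ast_{q'}(\diamond_{q'}W),$$ where $0\le p'\le p$, $0\le q'\le q$ are integers and $U$ is a class of formulas such that $\mathcal U_n$ contains no other formula of complexity $n$ arising from the other productions on the right-hand side. If $\mu_U$ exists, then $\mu_W$ exists and $$\lambda_W=\frac{\lambda_U}{1-p'r-q'r^2},\qquad \mu_W=\frac{\mu_U}{1-p'r-q'r^2}.$$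
   Context: Closed formulas over the alphabet are generated by $F::=\clubsuit_1\mid\cdots\mid\clubsuit_s\mid\diamond_1F\mid\cdots\mid\diamond_pF\mid F\ast_1F\mid\cdots\mid F\ast_qF$; the complexity of a formula is its total number of occurrences of connectives $\diamond_i$ and $\ast_j$. A class $W$ "given by productions" is the class of formulas generated recursively by those rules, where each occurrence of a class letter on the right-hand side stands for a (possibly different) formula of that class of strictly smaller complexity; $(V\setminus W)\ast_j W$ denotes formulas $A\ast_j B$ with $A\in V\setminus W$ and $B\in W$. *)

theory Defs
  imports "HOL-Analysis.Analysis"
begin

datatype form = Prim nat | Una nat form | Bin nat form form

primrec complexity :: "form \<Rightarrow> nat" where
  "complexity (Prim i) = 0"
| "complexity (Una i A) = Suc (complexity A)"
| "complexity (Bin j A B) = Suc (complexity A + complexity B)"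

text \<open>Connectives and primitive symbols are numbered from 1; only the indices within the
  alphabet yield closed formulas.\<close>

inductive_set formulas :: "nat \<Rightarrow> nat \<Rightarrow> nat \<Rightarrow> form set" for p q s :: nat where
  "i \<in> {1..s} \<Longrightarrow> Prim i \<in> formulas p q s"
| "i \<in> {1..p} \<Longrightarrow> A \<in> formulas p q s \<Longrightarrow> Una i A \<in> formulas p q s"
| "j \<in> {1..q} \<Longrightarrow> A \<in> formulas p q s \<Longrightarrow> B \<in> formulas p q s \<Longrightarrow> Bin j A B \<in> formulas p q s"

definition stratum :: "nat \<Rightarrow> nat \<Rightarrow> nat \<Rightarrow> form set \<Rightarrow> nat \<Rightarrow> form set" where
  "stratum p q s W n = {A \<in> W \<inter> formulas p q s. complexity A = n}"

text \<open>The reciprocal of the exponential growth rate of the number of closed formulas of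
  complexity \<open>n\<close>, i.e. the radius of convergence of their generating function.\<close>

definition growth_ratio :: "nat \<Rightarrow> nat \<Rightarrow> nat \<Rightarrow> real" where
  "growth_ratio p q s =
     1 / (real p + 2 * real q * real s + 2 * sqrt ((real p + real q * real s) * (real q * real s)))"

definition lambda_of :: "nat \<Rightarrow> nat \<Rightarrow> nat \<Rightarrow> form set \<Rightarrow> real" where
  "lambda_of p q s W = (\<Sum>n. growth_ratio p q s ^ (n + 1) * real (card (stratum p q s W n)))"

definition proportion :: "nat \<Rightarrow> nat \<Rightarrow> nat \<Rightarrow> form set \<Rightarrow> nat \<Rightarrow> real" where
  "proportion p q s W n =
     real (card (stratum p q s W n)) / real (card (stratum p q s (formulas p q s) n))"

definition mu_exists :: "nat \<Rightarrow> nat \<Rightarrow> nat \<Rightarrow> form set \<Rightarrow> bool" where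
  "mu_exists p q s W \<longleftrightarrow> convergent (proportion p q s W)"

definition mu_of :: "nat \<Rightarrow> nat \<Rightarrow> nat \<Rightarrow> form set \<Rightarrow> real" where
  "mu_of p q s W = lim (proportion p q s W)"

text \<open>Right-hand sides of productions for a class \<open>W\<close>: \<open>Self\<close> is the letter \<open>W\<close> being defined,
  \<open>Given U\<close> the letter of a previously given class \<open>U\<close>, and \<open>Minus_Self V\<close> stands for
  \<open>V \<setminus> W\<close>.\<close>

datatype production =
    Given "form set"
  | Self
  | Minus_Self "form set"
  | PPrim nat
  | PUna nat production
  | PBin nat production production

primrec instances :: "form set \<Rightarrow> production \<Rightarrow> form set" where
  "instances W (Given U) = U"
| "instances W Self = W"
| "instances W (Minus_Self V) = V - W"
| "instances W (PPrim i) = {Prim i}"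
| "instances W (PUna i P) = {Una i A | A. A \<in> instances W P}"
| "instances W (PBin j P Q) = {Bin j A B | A B. A \<in> instances W P \<and> B \<in> instances W Q}"

text \<open>Whether a formula is generated is decided by recursion on its complexity. An inductive
  definition would not do, as \<open>V \<setminus> W\<close> is not monotone in \<open>W\<close>.\<close>

declare conj_cong [fundef_cong]

function generated :: "production set \<Rightarrow> form \<Rightarrow> bool" where
  "generated G A \<longleftrightarrow>
     (\<exists>P\<in>G. A \<in> instances {B. complexity B < complexity A \<and> generated G B} P)"
  by pat_completeness auto

termination
  by (relation "inv_image less_than (\<lambda>(G, A). complexity A)") auto

declare conj_cong [fundef_cong del] generated.simps [simp del]

definition class_of :: "production set \<Rightarrow> form set" where
  "class_of G = {A. generated G A}"

text \<open>If every occurrence of the letter being defined lies below a connective, it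
  automatically stands for a formula of smaller complexity, and the class is the unique
  solution of its productions read as a set equation.\<close>

primrec guarded :: "production \<Rightarrow> bool" where
  "guarded (Given U) \<longleftrightarrow> True"
| "guarded Self \<longleftrightarrow> False"
| "guarded (Minus_Self V) \<longleftrightarrow> False"
| "guarded (PPrim i) \<longleftrightarrow> True"
| "guarded (PUna i P) \<longleftrightarrow> True"
| "guarded (PBin j P Q) \<longleftrightarrow> True"

lemma instances_cong_le:
  assumes "\<And>B. complexity B \<le> complexity A \<Longrightarrow> B \<in> W \<longleftrightarrow> B \<in> W'"
  shows "A \<in> instances W P \<longleftrightarrow> A \<in> instances W' P"
  using assms
proof (induction P arbitrary: A)
  case (PUna i P)
  have "B \<in> instances W P \<longleftrightarrow> B \<in> instances W' P" if "A = Una i B" for B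
    using that PUna by auto
  then show ?case by auto
next
  case (PBin j P Q)
  have "B \<in> instances W P \<longleftrightarrow> B \<in> instances W' P" "C \<in> instances W Q \<longleftrightarrow> C \<in> instances W' Q"
    if "A = Bin j B C" for B C
    using that PBin by auto
  then show ?case by auto
qed auto

lemma instances_cong_less:
  assumes "guarded P" and "\<And>B. complexity B < complexity A \<Longrightarrow> B \<in> W \<longleftrightarrow> B \<in> W'"
  shows "A \<in> instances W P \<longleftrightarrow> A \<in> instances W' P"
proof (cases P)
  case (PUna i Q)
  have "B \<in> instances W Q \<longleftrightarrow> B \<in> instances W' Q" if "A = Una i B" for B
    using that assms by (intro instances_cong_le) auto
  then show ?thesis using PUna by auto
next
  case (PBin j Q R)
  have "B \<in> instances W Q \<longleftrightarrow> B \<in> instances W' Q" "C \<in> instances W R \<longleftrightarrow> C \<in> instances W' R"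
    if "A = Bin j B C" for B C
    using that assms by (auto intro!: instances_cong_le)
  then show ?thesis using PBin by auto
qed (use assms in auto)

lemma class_of_unfold:
  assumes "\<And>P. P \<in> G \<Longrightarrow> guarded P"
  shows "class_of G = (\<Union>P\<in>G. instances (class_of G) P)"
proof -
  have "A \<in> class_of G \<longleftrightarrow> (\<exists>P\<in>G. A \<in> instances (class_of G) P)" for A
  proof -
    have "A \<in> instances {B. complexity B < complexity A \<and> generated G B} P
        \<longleftrightarrow> A \<in> instances (class_of G) P" if "P \<in> G" for P
      using assms that by (intro instances_cong_less) (auto simp: class_of_def)
    then show ?thesis
      by (subst class_of_def) (auto simp: generated.simps[of G A])
  qed
  then show ?thesis by auto
qed

lemma class_of_unique:
  assumes "\<And>P. P \<in> G \<Longrightarrow> guarded P" and "W = (\<Union>P\<in>G. instances W P)"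
  shows "W = class_of G"
proof -
  have "A \<in> W \<longleftrightarrow> A \<in> class_of G" for A
  proof (induction "complexity A" arbitrary: A rule: less_induct)
    case less
    have "A \<in> instances W P \<longleftrightarrow> A \<in> instances (class_of G) P" if "P \<in> G" for P
      using assms(1) that less by (intro instances_cong_less) auto
    then have "A \<in> (\<Union>P\<in>G. instances W P) \<longleftrightarrow> A \<in> (\<Union>P\<in>G. instances (class_of G) P)"
      by auto
    then show ?case
      using assms(2) class_of_unfold[OF assms(1)] by blast
  qed
  then show ?thesis by auto
qed

text \<open>\<open>G\<close> holds the productions of \<open>W\<close> other than \<open>W ::= U\<close>.\<close>

definition no_other :: "nat \<Rightarrow> nat \<Rightarrow> nat \<Rightarrow> form set \<Rightarrow> form set \<Rightarrow> production set \<Rightarrow> bool" where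
  "no_other p q s U W G \<longleftrightarrow>
     (\<forall>n. stratum p q s U n \<inter> stratum p q s (\<Union>P\<in>G. instances W P) n = {})"

end

theory Submission
  imports Defs "HOL-Computational_Algebra.Formal_Power_Series"
begin

text \<open>Put \<open>a\<^sub>n = r\<^sup>n\<^sup>+\<^sup>1 #F\<^sub>n\<close>. Then \<open>a\<^sub>n\<^sub>+\<^sub>1 = p r a\<^sub>n + q (a * a)\<^sub>n\<close>, where \<open>*\<close> is the Cauchy product, and
  \<open>r\<close> makes the quadratic equation for \<open>A = \<Sum>a\<close> have a double root, so \<open>A = (1 - p r) / (2 q)\<close>.
  A three-term recurrence gives \<open>a\<^sub>n\<^sub>+\<^sub>1 / a\<^sub>n \<longlonglongrightarrow> 1\<close>; by the equation above this already forces
  \<open>(a * a)\<^sub>n / a\<^sub>n \<longlonglongrightarrow> 2 A\<close>, i.e. in a Cauchy product of sequences dominated by \<open>a\<close> only the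
  terms near the two ends matter, and no finer asymptotics are needed. Explicit productions are
  then immediate. Recursive productions give
  \<open>w\<^sub>n\<^sub>+\<^sub>1 = u\<^sub>n\<^sub>+\<^sub>1 + (h * w)\<^sub>n + d (w * w)\<^sub>n\<close> with \<open>\<Sum>\<bar>h + 2 d w\<bar> < 1\<close>, which makes the deviation of
  \<open>w\<^sub>n / a\<^sub>n\<close> from the claimed limit contract.\<close>

section \<open>Subexponential sequences\<close>

definition cauchy_prod :: "(nat \<Rightarrow> real) \<Rightarrow> (nat \<Rightarrow> real) \<Rightarrow> nat \<Rightarrow> real" where
  "cauchy_prod u v n = (\<Sum>k\<le>n. u k * v (n - k))"

lemma cauchy_prod_sums:
  assumes "summable (\<lambda>n. \<bar>u n\<bar>)" "summable (\<lambda>n. \<bar>v n\<bar>)"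
  shows "cauchy_prod u v sums (suminf u * suminf v)"
  unfolding cauchy_prod_def using Cauchy_product_sums[of u v] assms by simp

text \<open>Iterating \<open>step\<close> from the initial bound yields eventual bounds by a
  geometric sequence. Both sides of \<open>step\<close> are eventual because in the applications the
  contraction carries an error that is small only beyond an index depending on
  \<open>B\<close>.\<close>

lemma tendsto_zero_contracting:
  fixes z :: "nat \<Rightarrow> real"
  assumes nonneg: "\<And>n. 0 \<le> z n" and bound: "\<forall>\<^sub>F n in sequentially. z n \<le> C"
    and \<theta>: "0 \<le> \<theta>" "\<theta> < 1"
    and step: "\<And>B. B > 0 \<Longrightarrow> \<forall>\<^sub>F n in sequentially. z n \<le> B
      \<Longrightarrow> \<forall>\<^sub>F n in sequentially. z (Suc n) \<le> \<theta> * B"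
  shows "z \<longlonglongrightarrow> 0"
proof (rule LIMSEQ_I)
  fix \<epsilon> :: real assume \<epsilon>: "\<epsilon> > 0"
  \<comment> \<open>\<open>step\<close> accepts only positive bounds, while \<open>C\<close> may be
    0.\<close>
  define D where "D = max C 1"
  have D: "D > 0" "\<forall>\<^sub>F n in sequentially. z n \<le> D"
    using bound by (auto simp: D_def elim: eventually_mono)
  \<comment> \<open>Replacing \<theta> by \<open>max \<theta> (1/2)\<close> keeps all iterated
    bounds positive, also when \<theta> is 0.\<close>
  have step': "\<forall>\<^sub>F n in sequentially. z n \<le> max \<theta> (1/2) * B"
    if B: "B > 0" and ev: "\<forall>\<^sub>F n in sequentially. z n \<le> B" for B
  proof -
    have "\<forall>\<^sub>F n in sequentially. z (Suc n) \<le> max \<theta> (1/2) * B"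
    proof (rule eventually_mono[OF step[OF that]])
      fix n assume "z (Suc n) \<le> \<theta> * B"
      also have "\<dots> \<le> max \<theta> (1/2) * B" using B by (intro mult_right_mono) auto
      finally show "z (Suc n) \<le> max \<theta> (1/2) * B" .
    qed
    then show ?thesis by (rule iffD1[OF eventually_sequentially_Suc])
  qed
  have iter: "\<forall>\<^sub>F n in sequentially. z n \<le> max \<theta> (1/2) ^ k * D" for k
  proof (induction k)
    case 0 then show ?case using D by simp
  next
    case (Suc k)
    have "max \<theta> (1/2) ^ k * D > 0" using D by (intro mult_pos_pos zero_less_power) auto
    from step'[OF this Suc] show ?case by (simp add: mult.assoc)
  qed
  have "(\<lambda>k. max \<theta> (1/2) ^ k * D) \<longlonglongrightarrow> 0 * D"
    by (intro tendsto_mult LIMSEQ_power_zero tendsto_const) (use \<theta> in auto)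
  then have "\<forall>\<^sub>F k in sequentially. max \<theta> (1/2) ^ k * D < \<epsilon>"
    using \<epsilon> order_tendstoD(2) by fastforce
  then obtain k where "max \<theta> (1/2) ^ k * D < \<epsilon>"
    by (auto simp: eventually_sequentially)
  then have "\<forall>\<^sub>F n in sequentially. z n < \<epsilon>"
    using iter[of k] by (auto elim: eventually_mono)
  then show "\<exists>N. \<forall>n\<ge>N. norm (z n - 0) < \<epsilon>"
    using nonneg by (auto simp: eventually_sequentially)
qed

text \<open>The subexponential sequences of renewal theory (Chover, Ney, Wainger), normalised to
  radius of convergence 1. The condition \<open>square\<close> says that a large total index in a
  convolution comes almost entirely from one of the two factors.\<close>

locale subexponential =
  fixes a :: "nat \<Rightarrow> real"
  assumes pos: "\<And>n. a n > 0"
    and ratio: "(\<lambda>n. a (Suc n) / a n) \<longlonglongrightarrow> 1"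
    and summable: "summable a"
    and square: "(\<lambda>n. cauchy_prod a a n / a n) \<longlonglongrightarrow> 2 * suminf a"
begin

lemma nonzero [simp]: "a n \<noteq> 0"
  using pos[of n] by simp

lemma ratio_inverse: "(\<lambda>n. a n / a (Suc n)) \<longlonglongrightarrow> 1"
  using tendsto_inverse[OF ratio] by (simp add: inverse_eq_divide)

lemma ratio_shift: "(\<lambda>n. a (n - i) / a n) \<longlonglongrightarrow> 1"
proof -
  have "(\<lambda>n. a n / a (n + i)) \<longlonglongrightarrow> 1"
  proof (induction i)
    case (Suc i)
    have "(\<lambda>n. a (n + i) / a (Suc (n + i))) \<longlonglongrightarrow> 1"
      using LIMSEQ_ignore_initial_segment[OF ratio_inverse, of i] by simp
    from tendsto_mult[OF Suc this] show ?case by simp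
  qed simp
  \<comment> \<open>The offset \<open>i\<close> removes the truncation of \<open>n - i\<close> at
    0.\<close>
  then show ?thesis
    using LIMSEQ_offset[where k=i and f="\<lambda>n. a (n - i) / a n"] by simp
qed

lemma tendsto_shift:
  assumes "(\<lambda>n. h n / a n) \<longlonglongrightarrow> \<eta>"
  shows "(\<lambda>n. h (n - i) / a n) \<longlonglongrightarrow> \<eta>"
proof -
  have "(\<lambda>n. h (n - i) / a (n - i)) \<longlonglongrightarrow> \<eta>"
    using LIMSEQ_offset[where k=i and f="\<lambda>n. h (n - i) / a (n - i)"] assms by simp
  from tendsto_mult[OF this ratio_shift[of i]] show ?thesis by simp
qed

lemma summable_dominated:
  assumes "\<And>n. \<bar>h n\<bar> \<le> C * a n"
  shows "summable (\<lambda>n. \<bar>h n\<bar>)" "summable h"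
proof -
  show "summable (\<lambda>n. \<bar>h n\<bar>)"
    by (rule summable_comparison_test[OF _ summable_mult[OF summable, of C]]) (use assms in auto)
  then show "summable h" by (rule summable_rabs_cancel)
qed

text \<open>The middle part of the convolution is dominated by that of \<open>a * a\<close>, whose relative size
  tends to \<open>2 \<Sum>a - 2 \<Sum>\<^sub>i\<^sub><\<^sub>M a\<^sub>i\<close>.\<close>

lemma cauchy_prod_split:
  assumes h: "\<And>n. \<bar>h n\<bar> \<le> C * a n" and k: "\<And>n. \<bar>k n\<bar> \<le> D * a n" and \<epsilon>: "\<epsilon> > 0"
  shows "\<forall>\<^sub>F M in sequentially. \<forall>\<^sub>F n in sequentially.
    \<bar>cauchy_prod h k n - (\<Sum>i<M. h i * k (n - i) + k i * h (n - i))\<bar> \<le> \<epsilon> * a n"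
proof -
  \<comment> \<open>The upper end \<open>i > n - M\<close> is reflected by
    \<open>i \<mapsto> n - i\<close> onto the range of the lower end; \<open>2 * M \<le> n\<close>
    keeps the ends disjoint.\<close>
  have split: "cauchy_prod x y n - (\<Sum>i<M. x i * y (n - i) + y i * x (n - i))
      = (\<Sum>i\<in>{M..n-M}. x i * y (n - i))" if "2 * M \<le> n" for x y M n
  proof -
    have eq: "{..n} = {..<M} \<union> {M..n-M} \<union> {n-M<..n}" using that by auto
    have "cauchy_prod x y n = (\<Sum>i<M. x i * y (n - i)) + (\<Sum>i\<in>{M..n-M}. x i * y (n - i))
        + (\<Sum>i\<in>{n-M<..n}. x i * y (n - i))"
      unfolding cauchy_prod_def eq using that
      by (subst sum.union_disjoint; (subst sum.union_disjoint)?) auto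
    moreover have "(\<Sum>i\<in>{n-M<..n}. x i * y (n - i)) = (\<Sum>i<M. y i * x (n - i))"
      by (rule sum.reindex_bij_witness[of _ "\<lambda>k. n - k" "\<lambda>k. n - k"]) (use that in auto)
    ultimately show ?thesis by (simp add: sum.distrib)
  qed
  define E where "E = max 1 (C * D)"
  have "C \<ge> 0" "D \<ge> 0"
    using h[of 0] k[of 0] pos[of 0] abs_ge_zero order_trans zero_le_mult_iff less_le_not_le by metis+
  \<comment> \<open>The limit is 0: the two ends together use up \<open>2 * suminf a\<close>. First
    \<open>M\<close> is chosen, and only then does \<open>n\<close> grow.\<close>
  have "(\<lambda>M. E * (2 * suminf a - (\<Sum>i<M. a i + a i))) \<longlonglongrightarrow> E * (2 * suminf a - (suminf a + suminf a))"
    unfolding sum.distrib by (intro tendsto_intros summable_LIMSEQ summable)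
  then have "\<forall>\<^sub>F M in sequentially. E * (2 * suminf a - (\<Sum>i<M. a i + a i)) < \<epsilon>"
    using \<epsilon> by (intro order_tendstoD(2)) auto
  then show ?thesis
  proof (rule eventually_mono)
    fix M assume M: "E * (2 * suminf a - (\<Sum>i<M. a i + a i)) < \<epsilon>"
    have "(\<lambda>n. E * (cauchy_prod a a n / a n - (\<Sum>i<M. a i * (a (n-i) / a n) + a i * (a (n - i) / a n))))
       \<longlonglongrightarrow> E * (2 * suminf a - (\<Sum>i<M. a i * 1 + a i * 1))"
      by (intro tendsto_intros square ratio_shift)
    then have "\<forall>\<^sub>F n in sequentially.
        E * (cauchy_prod a a n / a n - (\<Sum>i<M. a i * (a (n-i) / a n) + a i * (a (n - i) / a n))) < \<epsilon>"
      using M by (intro order_tendstoD(2)) auto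
    then show "\<forall>\<^sub>F n in sequentially.
        \<bar>cauchy_prod h k n - (\<Sum>i<M. h i * k (n - i) + k i * h (n - i))\<bar> \<le> \<epsilon> * a n"
      using eventually_ge_at_top[of "2 * M"]
    proof eventually_elim
      case (elim n)
      have "E * (\<Sum>i\<in>{M..n-M}. a i * a (n - i)) / a n
        = E * (cauchy_prod a a n / a n - (\<Sum>i<M. a i * (a (n-i) / a n) + a i * (a (n - i) / a n)))"
        by (subst split[symmetric, OF elim(2)])
          (simp add: field_simps sum_divide_distrib[symmetric] add_divide_distrib[symmetric] sum_distrib_left[symmetric])
      with elim have "E * (\<Sum>i\<in>{M..n-M}. a i * a (n - i)) / a n < \<epsilon>" by simp
      then have le: "E * (\<Sum>i\<in>{M..n-M}. a i * a (n - i)) < \<epsilon> * a n"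
        using pos[of n] by (simp add: field_simps)
      have "\<bar>\<Sum>i\<in>{M..n-M}. h i * k (n - i)\<bar> \<le> (\<Sum>i\<in>{M..n-M}. \<bar>h i * k (n - i)\<bar>)" by (rule sum_abs)
      also have "\<dots> \<le> (\<Sum>i\<in>{M..n-M}. E * (a i * a (n - i)))"
      proof (rule sum_mono)
        fix i
        have "\<bar>h i * k (n - i)\<bar> \<le> (C * a i) * (D * a (n - i))"
          unfolding abs_mult using \<open>C \<ge> 0\<close> pos[of i] by (intro mult_mono h k) auto
        also have "\<dots> = (C * D) * (a i * a (n - i))" by simp
        also have "\<dots> \<le> E * (a i * a (n - i))"
          using pos[of i] pos[of "n - i"] by (intro mult_right_mono) (auto simp: E_def)
        finally show "\<bar>h i * k (n - i)\<bar> \<le> E * (a i * a (n - i))" .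
      qed
      finally show ?case using le split[OF elim(2), of h k] by (simp add: sum_distrib_left)
    qed
  qed
qed

text \<open>For fixed \<open>M\<close> both ends of the convolution are finite sums, so their limits
  can be taken termwise by \<open>tendsto_shift\<close>. This gives a partial sum of the claimed
  value, and \<open>cauchy_prod_split\<close> makes the middle negligible.\<close>

lemma cauchy_prod_tendsto:
  assumes h: "\<And>n. \<bar>h n\<bar> \<le> C * a n" and k: "\<And>n. \<bar>k n\<bar> \<le> D * a n"
    and hl: "(\<lambda>n. h n / a n) \<longlonglongrightarrow> \<eta>" and kl: "(\<lambda>n. k n / a n) \<longlonglongrightarrow> \<kappa>"
  shows "(\<lambda>n. cauchy_prod h k n / a n) \<longlonglongrightarrow> suminf h * \<kappa> + suminf k * \<eta>"
proof (rule tendstoI)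
  fix \<epsilon> :: real assume \<epsilon>: "\<epsilon> > 0"
  let ?l = "suminf h * \<kappa> + suminf k * \<eta>"
  have "(\<lambda>M. \<Sum>i<M. h i * \<kappa> + k i * \<eta>) \<longlonglongrightarrow> ?l"
    unfolding sum.distrib sum_distrib_right[symmetric]
    using h k by (intro tendsto_intros summable_LIMSEQ summable_dominated) auto
  \<comment> \<open>The error budget: \<epsilon>/2 for cutting the limit at \<open>M\<close>,
    \<epsilon>/4 for the middle part, \<epsilon>/4 for the convergence of the ends.\<close>
  then have "\<forall>\<^sub>F M in sequentially. dist (\<Sum>i<M. h i * \<kappa> + k i * \<eta>) ?l < \<epsilon>/2"
    using \<epsilon> by (intro tendstoD) auto
  moreover have "\<forall>\<^sub>F M in sequentially. \<forall>\<^sub>F n in sequentially.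
    \<bar>cauchy_prod h k n - (\<Sum>i<M. h i * k (n - i) + k i * h (n - i))\<bar> \<le> (\<epsilon>/4) * a n"
    by (rule cauchy_prod_split[OF h k]) (use \<epsilon> in simp)
  ultimately have "\<forall>\<^sub>F M in sequentially. dist (\<Sum>i<M. h i * \<kappa> + k i * \<eta>) ?l < \<epsilon>/2 \<and>
    (\<forall>\<^sub>F n in sequentially.
    \<bar>cauchy_prod h k n - (\<Sum>i<M. h i * k (n - i) + k i * h (n - i))\<bar> \<le> (\<epsilon>/4) * a n)"
    by (rule eventually_conj)
  from eventually_happens'[OF sequentially_bot this] obtain M where M: "dist (\<Sum>i<M. h i * \<kappa> + k i * \<eta>) ?l < \<epsilon>/2"
    "\<forall>\<^sub>F n in sequentially.
    \<bar>cauchy_prod h k n - (\<Sum>i<M. h i * k (n - i) + k i * h (n - i))\<bar> \<le> (\<epsilon>/4) * a n"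
    by blast
  have "(\<lambda>n. (\<Sum>i<M. h i * (k (n - i) / a n) + k i * (h (n - i) / a n)))
      \<longlonglongrightarrow> (\<Sum>i<M. h i * \<kappa> + k i * \<eta>)"
    by (intro tendsto_intros tendsto_shift hl kl)
  then have "\<forall>\<^sub>F n in sequentially. dist (\<Sum>i<M. h i * (k (n - i) / a n) + k i * (h (n - i) / a n))
      (\<Sum>i<M. h i * \<kappa> + k i * \<eta>) < \<epsilon>/4"
    using \<epsilon> by (intro tendstoD) auto
  with M(2) show "\<forall>\<^sub>F n in sequentially. dist (cauchy_prod h k n / a n) ?l < \<epsilon>"
  proof eventually_elim
    case (elim n)
    define S where "S = (\<Sum>i<M. h i * k (n - i) + k i * h (n - i))"
    have S: "(\<Sum>i<M. h i * (k (n - i) / a n) + k i * (h (n - i) / a n)) = S / a n"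
      by (simp add: S_def sum_divide_distrib add_divide_distrib)
    have "\<bar>cauchy_prod h k n / a n - S / a n\<bar> = \<bar>cauchy_prod h k n - S\<bar> / a n"
      using pos[of n] by (simp add: diff_divide_distrib[symmetric])
    also have "\<dots> \<le> \<epsilon> / 4"
      using elim(1) pos[of n] by (simp add: S_def field_simps)
    finally show ?case using elim(2) M(1) unfolding S dist_real_def by linarith
  qed
qed

text \<open>Summing \<open>rec\<close> gives the quadratic equation. For the limit,
  \<open>rec\<close> is split into the ends and the middle of its convolutions: the deviation of
  \<open>w n / a n\<close> from the limit then obeys a linear recurrence with coefficients
  \<open>h k + 2 * d * w k\<close>, and \<open>c\<close> bounds their total absolute value below
  1.\<close>

lemma implicit_class:
  assumes rec: "\<And>n. w (Suc n) = u (Suc n) + cauchy_prod h w n + d * cauchy_prod w w n"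
    and w0: "w 0 = u 0"
    and w: "\<And>n. \<bar>w n\<bar> \<le> C * a n" and h: "\<And>n. \<bar>h n\<bar> \<le> D * a n" and u: "\<And>n. \<bar>u n\<bar> \<le> E * a n"
    and ul: "(\<lambda>n. u n / a n) \<longlonglongrightarrow> \<mu>" and hl: "(\<lambda>n. h n / a n) \<longlonglongrightarrow> \<eta>"
    and c: "(\<Sum>k. \<bar>h k + 2 * d * w k\<bar>) < 1"
  shows "suminf w = suminf u + suminf h * suminf w + d * (suminf w)\<^sup>2"
    and "suminf h + 2 * d * suminf w < 1"
    and "(\<lambda>n. w n / a n) \<longlonglongrightarrow> (\<mu> + \<eta> * suminf w) / (1 - suminf h - 2 * d * suminf w)"
proof -
  note sw = summable_dominated[OF w] and sh = summable_dominated[OF h] and su = summable_dominated[OF u]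
  show "suminf w = suminf u + suminf h * suminf w + d * (suminf w)\<^sup>2"
  proof -
    have "(\<lambda>n. u (Suc n) + cauchy_prod h w n + d * cauchy_prod w w n) sums
        ((suminf u - u 0) + suminf h * suminf w + d * (suminf w * suminf w))"
      using summable_sums[OF su(2)] sw sh
      by (intro sums_add sums_mult cauchy_prod_sums) (auto simp: sums_Suc_iff)
    then have "(\<lambda>n. w (Suc n)) sums ((suminf u - u 0) + suminf h * suminf w + d * (suminf w * suminf w))"
      by (simp add: rec)
    moreover have "(\<lambda>n. w (Suc n)) sums (suminf w - w 0)"
      using summable_sums[OF sw(2)] by (simp add: sums_Suc_iff)
    ultimately have "suminf w - w 0 = (suminf u - u 0) + suminf h * suminf w + d * (suminf w * suminf w)"
      using sums_unique2 by blast
    then show ?thesis using w0 by (simp add: power2_eq_square)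
  qed
  \<comment> \<open>The coefficient of \<open>w (n - k)\<close> in the end sums: \<open>h k\<close>
    from \<open>h * w\<close>, and \<open>w k\<close> from each of the two ends of
    \<open>d (w * w)\<close>.\<close>
  define t where "t k = h k + 2 * d * w k" for k
  define c where "c = (\<Sum>k. \<bar>t k\<bar>)"
  have c1: "c < 1" using c by (simp add: t_def c_def)
  have st: "summable (\<lambda>k. \<bar>t k\<bar>)"
  proof (rule summable_comparison_test[OF _ summable_add[OF sh(1) summable_mult[OF sw(1), of "\<bar>2 * d\<bar>"]]])
    show "\<exists>N. \<forall>n\<ge>N. norm \<bar>t n\<bar> \<le> \<bar>h n\<bar> + \<bar>2 * d\<bar> * \<bar>w n\<bar>"
      unfolding t_def by (metis abs_mult abs_triangle_ineq real_norm_def abs_abs)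
  qed
  have c0: "c \<ge> 0" unfolding c_def by (rule suminf_nonneg[OF st]) simp
  have T: "suminf t = suminf h + 2 * d * suminf w"
    unfolding t_def using sh(2) sw(2) by (simp add: suminf_add[symmetric] suminf_mult[symmetric] summable_mult)
  have Tc: "suminf t \<le> c" unfolding c_def
    using summable_rabs_cancel[OF st] st by (intro suminf_le) auto
  then show T1: "suminf h + 2 * d * suminf w < 1" using c1 T by simp
  \<comment> \<open>The fixed point of the recurrence in the limit, as the next fact states.\<close>
  define m where "m = (\<mu> + \<eta> * suminf w) / (1 - suminf h - 2 * d * suminf w)"
  have m: "\<mu> + m * suminf t + suminf w * \<eta> - m = 0"
    using T1 unfolding T m_def by (simp add: field_simps)
  have "(\<lambda>n. \<bar>w n / a n - m\<bar>) \<longlonglongrightarrow> 0"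
  proof (rule tendsto_zero_contracting[where \<theta> = "(1 + c) / 2"])
    show "\<forall>\<^sub>F n in sequentially. \<bar>w n / a n - m\<bar> \<le> C + \<bar>m\<bar>"
    proof (rule always_eventually, rule)
      fix n
      have "\<bar>w n / a n\<bar> \<le> C" using w[of n] pos[of n] by (simp add: field_simps)
      then show "\<bar>w n / a n - m\<bar> \<le> C + \<bar>m\<bar>" by linarith
    qed
  next
    fix B :: real assume B: "B > 0" and ev: "\<forall>\<^sub>F n in sequentially. \<bar>w n / a n - m\<bar> \<le> B"
    \<comment> \<open>The factor \<open>(1 + c) / 2\<close> exceeds the true contraction
      \<open>c\<close> by \<open>(1 - c) / 2\<close>; the errors to be absorbed stay below
      \<open>2 * \<epsilon>\<close>, half of that gap times \<open>B\<close>.\<close>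
    define \<epsilon> where "\<epsilon> = (1 - c) * B / 8"
    have \<epsilon>: "\<epsilon> > 0" using B c1 by (simp add: \<epsilon>_def)
    \<comment> \<open>The residue of the fixed point equation when its series are cut at
      \<open>M\<close>.\<close>
    define \<kappa> where "\<kappa> M = \<mu> + m * (\<Sum>i<M. t i) + (\<Sum>i<M. w i) * \<eta> - m" for M
    \<comment> \<open>The middle parts of \<open>h * w\<close> and of \<open>d (w * w)\<close>
      together then contribute at most \<open>\<epsilon> * a n\<close>.\<close>
    define \<epsilon>2 where "\<epsilon>2 = \<epsilon> / (1 + \<bar>d\<bar>)"
    have \<epsilon>2: "\<epsilon>2 > 0" "(1 + \<bar>d\<bar>) * \<epsilon>2 = \<epsilon>" using \<epsilon>
      by (auto simp: \<epsilon>2_def add_pos_nonneg)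
    have "\<kappa> \<longlonglongrightarrow> \<mu> + m * suminf t + suminf w * \<eta> - m"
      unfolding \<kappa>_def by (intro tendsto_intros summable_LIMSEQ sw(2) summable_rabs_cancel[OF st])
    then have "\<kappa> \<longlonglongrightarrow> 0" using m by simp
    then have "\<forall>\<^sub>F M in sequentially. \<bar>\<kappa> M\<bar> < \<epsilon>"
      using \<epsilon> by (auto simp: dist_real_def dest: tendstoD)
    then have "\<forall>\<^sub>F M in sequentially. \<bar>\<kappa> M\<bar> < \<epsilon> \<and>
      (\<forall>\<^sub>F n in sequentially.
        \<bar>cauchy_prod h w n - (\<Sum>i<M. h i * w (n - i) + w i * h (n - i))\<bar> \<le> \<epsilon>2 * a n) \<and>
      (\<forall>\<^sub>F n in sequentially.
        \<bar>cauchy_prod w w n - (\<Sum>i<M. w i * w (n - i) + w i * w (n - i))\<bar> \<le> \<epsilon>2 * a n)"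
      by (intro eventually_conj cauchy_prod_split[OF h w] cauchy_prod_split[OF w w] \<epsilon>2)
    from eventually_happens'[OF sequentially_bot this] obtain M where M: "\<bar>\<kappa> M\<bar> < \<epsilon>"
      "\<forall>\<^sub>F n in sequentially.
        \<bar>cauchy_prod h w n - (\<Sum>i<M. h i * w (n - i) + w i * h (n - i))\<bar> \<le> \<epsilon>2 * a n"
      "\<forall>\<^sub>F n in sequentially.
        \<bar>cauchy_prod w w n - (\<Sum>i<M. w i * w (n - i) + w i * w (n - i))\<bar> \<le> \<epsilon>2 * a n"
      by blast
    define \<rho> where "\<rho> i n = a (n - i) / a n" for i n
    \<comment> \<open>\<open>K\<close> collects what is neither a middle part nor a multiple of a
      deviation; it tends to \<open>\<kappa> M\<close>. \<open>X\<close> will bound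
      \<open>\<bar>w (Suc n) / a n - m\<bar>\<close>.\<close>
    define K where "K n = u (Suc n) / a n + m * (\<Sum>i<M. t i * \<rho> i n)
      + (\<Sum>i<M. w i * (h (n - i) / a n)) - m" for n
    define X where "X n = \<epsilon> + B * (\<Sum>i<M. \<bar>t i\<bar> * \<rho> i n) + \<bar>K n\<bar>" for n
    have us: "(\<lambda>n. u (Suc n) / a n) \<longlonglongrightarrow> \<mu>"
      using tendsto_mult[OF LIMSEQ_Suc[OF ul] ratio] by simp
    have "X \<longlonglongrightarrow> \<epsilon> + B * (\<Sum>i<M. \<bar>t i\<bar> * 1)
        + \<bar>\<mu> + m * (\<Sum>i<M. t i * 1) + (\<Sum>i<M. w i * \<eta>) - m\<bar>"
      unfolding X_def K_def \<rho>_def by (intro tendsto_intros ratio_shift tendsto_shift hl us)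
    then have Xl: "X \<longlonglongrightarrow> \<epsilon> + B * (\<Sum>i<M. \<bar>t i\<bar>) + \<bar>\<kappa> M\<bar>"
      by (simp add: \<kappa>_def sum_distrib_right)
    \<comment> \<open>Accounts for the change of denominator from \<open>a n\<close> to
      \<open>a (Suc n)\<close>.\<close>
    have "(\<lambda>n. X n * (a n / a (Suc n)) + \<bar>m\<bar> * \<bar>a n / a (Suc n) - 1\<bar>)
        \<longlonglongrightarrow> (\<epsilon> + B * (\<Sum>i<M. \<bar>t i\<bar>) + \<bar>\<kappa> M\<bar>) * 1 + \<bar>m\<bar> * \<bar>1 - 1\<bar>"
      by (intro tendsto_intros Xl ratio_inverse)
    moreover have "(\<epsilon> + B * (\<Sum>i<M. \<bar>t i\<bar>) + \<bar>\<kappa> M\<bar>) * 1 + \<bar>m\<bar> * \<bar>1 - 1\<bar> < (1 + c) / 2 * B"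
    proof -
      have "(\<Sum>i<M. \<bar>t i\<bar>) \<le> c" unfolding c_def by (rule sum_le_suminf[OF st]) auto
      then have "B * (\<Sum>i<M. \<bar>t i\<bar>) \<le> B * c" using B by simp
      moreover have "2 * \<epsilon> + B * c < (1 + c) / 2 * B" using B c1
        by (simp add: \<epsilon>_def field_simps)
      ultimately show ?thesis using M(1) by simp
    qed
    ultimately have fin: "\<forall>\<^sub>F n in sequentially.
        X n * (a n / a (Suc n)) + \<bar>m\<bar> * \<bar>a n / a (Suc n) - 1\<bar> < (1 + c) / 2 * B"
      by (rule order_tendstoD(2))
    have ev': "\<forall>\<^sub>F n in sequentially. \<forall>i<M. \<bar>w (n - i) / a (n - i) - m\<bar> \<le> B"
    proof -
      obtain N where N: "\<And>n. n \<ge> N \<Longrightarrow> \<bar>w n / a n - m\<bar> \<le> B"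
        using ev by (auto simp: eventually_sequentially)
      show ?thesis
        unfolding eventually_sequentially by (rule exI[of _ "N + M"]) (auto intro!: N)
    qed
    show "\<forall>\<^sub>F n in sequentially. \<bar>w (Suc n) / a (Suc n) - m\<bar> \<le> (1 + c) / 2 * B"
      using fin M(2,3) ev'
    proof eventually_elim
      case (elim n)
      define S where "S = (\<Sum>i<M. t i * w (n - i)) + (\<Sum>i<M. w i * h (n - i))"
      have S: "S = (\<Sum>i<M. h i * w (n - i) + w i * h (n - i))
          + d * (\<Sum>i<M. w i * w (n - i) + w i * w (n - i))"
        unfolding S_def t_def sum_distrib_left sum.distrib[symmetric]
        by (intro sum.cong) (auto simp: algebra_simps)
      have "\<bar>d * cauchy_prod w w n - d * (\<Sum>i<M. w i * w (n - i) + w i * w (n - i))\<bar> \<le> \<bar>d\<bar> * (\<epsilon>2 * a n)"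
        unfolding right_diff_distrib[symmetric] abs_mult using elim(3) by (intro mult_left_mono) auto
      then have "\<bar>w (Suc n) - u (Suc n) - S\<bar> \<le> \<epsilon>2 * a n + \<bar>d\<bar> * (\<epsilon>2 * a n)"
        using elim(2) unfolding S rec by linarith
      also have "\<dots> = \<epsilon> * a n" using \<epsilon>2(2) by (simp add: algebra_simps flip: \<epsilon>2(2))
      finally have "\<bar>(w (Suc n) - u (Suc n) - S) / a n\<bar> \<le> \<epsilon>"
        using pos[of n] by (simp add: field_simps)
      moreover have "\<bar>\<Sum>i<M. t i * ((w (n - i) / a (n - i) - m) * \<rho> i n)\<bar> \<le> B * (\<Sum>i<M. \<bar>t i\<bar> * \<rho> i n)"
      proof -
        have "\<bar>\<Sum>i<M. t i * ((w (n - i) / a (n - i) - m) * \<rho> i n)\<bar>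
            \<le> (\<Sum>i<M. \<bar>t i * ((w (n - i) / a (n - i) - m) * \<rho> i n)\<bar>)" by (rule sum_abs)
        also have "\<dots> \<le> (\<Sum>i<M. B * (\<bar>t i\<bar> * \<rho> i n))"
        proof (rule sum_mono)
          fix i assume "i \<in> {..<M}"
          then have "\<bar>w (n - i) / a (n - i) - m\<bar> * (\<bar>t i\<bar> * \<rho> i n) \<le> B * (\<bar>t i\<bar> * \<rho> i n)"
            using elim(4) pos[of n] pos[of "n - i"] by (intro mult_right_mono) (auto simp: \<rho>_def)
          moreover have "\<bar>\<rho> i n\<bar> = \<rho> i n" using pos[of n] pos[of "n - i"] by (simp add: \<rho>_def)
          ultimately show "\<bar>t i * ((w (n - i) / a (n - i) - m) * \<rho> i n)\<bar> \<le> B * (\<bar>t i\<bar> * \<rho> i n)"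
            by (simp add: abs_mult mult_ac)
        qed
        finally show ?thesis by (simp add: sum_distrib_left)
      qed
      \<comment> \<open>Each \<open>w (n - i) / a n\<close> is written as its deviation times
        \<open>\<rho> i n\<close> plus \<open>m * \<rho> i n\<close>; the second summand goes into
        \<open>K\<close>.\<close>
      moreover have "w (Suc n) / a n - m = (w (Suc n) - u (Suc n) - S) / a n
          + (\<Sum>i<M. t i * ((w (n - i) / a (n - i) - m) * \<rho> i n)) + K n"
      proof -
        have "(\<Sum>i<M. t i * ((w (n - i) / a (n - i) - m) * \<rho> i n))
            = (\<Sum>i<M. t i * w (n - i)) / a n - m * (\<Sum>i<M. t i * \<rho> i n)"
          unfolding sum_divide_distrib sum_distrib_left sum_subtractf[symmetric]
          by (intro sum.cong) (auto simp: \<rho>_def field_simps)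
        then show ?thesis
          unfolding K_def S_def by (simp add: diff_divide_distrib add_divide_distrib sum_divide_distrib)
      qed
      ultimately have "\<bar>w (Suc n) / a n - m\<bar> \<le> X n" unfolding X_def by linarith
      then have "\<bar>w (Suc n) / a n - m\<bar> * (a n / a (Suc n)) \<le> X n * (a n / a (Suc n))"
        using pos[of n] pos[of "Suc n"] by (intro mult_right_mono) auto
      moreover have "\<bar>w (Suc n) / a (Suc n) - m\<bar>
          \<le> \<bar>w (Suc n) / a n - m\<bar> * (a n / a (Suc n)) + \<bar>m\<bar> * \<bar>a n / a (Suc n) - 1\<bar>"
      proof -
        have "w (Suc n) / a (Suc n) - m = (w (Suc n) / a n - m) * (a n / a (Suc n)) + m * (a n / a (Suc n) - 1)"
          by (simp add: field_simps)
        moreover have "\<bar>a n / a (Suc n)\<bar> = a n / a (Suc n)" using pos[of n] pos[of "Suc n"] by simp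
        ultimately show ?thesis by (metis abs_mult abs_triangle_ineq)
      qed
      ultimately show ?case using elim(1) by linarith
    qed
  qed (use c0 c1 in auto)
  then have "(\<lambda>n. w n / a n) \<longlonglongrightarrow> m"
    by (simp add: tendsto_rabs_zero_iff LIM_zero_iff)
  then show "(\<lambda>n. w n / a n) \<longlonglongrightarrow> (\<mu> + \<eta> * suminf w) / (1 - suminf h - 2 * d * suminf w)"
    by (simp add: m_def)
qed

end

section \<open>Sequences with quadratic generating function\<close>

text \<open>With generating function \<open>F\<close>, the series \<open>Y = 1 - c X - 2 q X F\<close> is the square root of the
  discriminant \<open>D = (1 - c X)\<^sup>2 - 4 q e X\<close>; comparing coefficients in \<open>2 Y' D = D' Y\<close>
  gives the recurrence.\<close>

lemma quadratic_recurrence: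
  fixes a :: "nat \<Rightarrow> real"
  assumes a0: "a 0 = e" and rec: "\<And>n. a (Suc n) = c * a n + q * cauchy_prod a a n" and q: "q \<noteq> 0"
  shows "(real m + 3) * a (m + 2) = (c + 2 * q * e) * (2 * real m + 3) * a (m + 1) - c\<^sup>2 * real m * a m"
proof -
  define F where "F = Abs_fps a"
  define Y where "Y = 1 - fps_const c * fps_X - fps_const (2 * q) * fps_X * F"
  \<comment> \<open>\<open>-2 * b\<close> is the linear coefficient of the discriminant.\<close>
  define b where "b = c + 2 * q * e"
  define D where "D = 1 - fps_const (2 * b) * fps_X + fps_const (c\<^sup>2) * fps_X\<^sup>2"
  have F2: "fps_nth (F\<^sup>2) n = cauchy_prod a a n" for n
    by (simp add: F_def power2_eq_square fps_mult_nth cauchy_prod_def atLeast0AtMost)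
  have F: "F = fps_const e + fps_const c * fps_X * F + fps_const q * fps_X * F\<^sup>2"
  proof (rule fps_ext)
    fix n show "fps_nth F n = fps_nth (fps_const e + fps_const c * fps_X * F + fps_const q * fps_X * F\<^sup>2) n"
      by (cases n) (simp_all add: F2 mult.assoc, simp_all add: F_def a0 rec)
  qed
  \<comment> \<open>Completing the square in the equation for \<open>F\<close>.\<close>
  have Y2: "Y\<^sup>2 = D"
  proof -
    have "Y\<^sup>2 = (1 - fps_const c * fps_X)\<^sup>2 - 4 * fps_const q * fps_X *
        (F - fps_const c * fps_X * F - fps_const q * fps_X * F\<^sup>2)"
      unfolding Y_def fps_const_mult[symmetric] fps_numeral_fps_const[symmetric]
      by (simp add: power2_eq_square algebra_simps)
    also have "F - fps_const c * fps_X * F - fps_const q * fps_X * F\<^sup>2 = fps_const e"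
      using F by (simp add: algebra_simps)
    also have "(1 - fps_const c * fps_X)\<^sup>2 - 4 * fps_const q * fps_X * fps_const e = D"
      unfolding D_def b_def fps_const_mult[symmetric] fps_const_add[symmetric]
        fps_numeral_fps_const[symmetric] power2_eq_square
      by (simp add: algebra_simps)
    finally show ?thesis .
  qed
  have "Y * (2 * fps_deriv Y * D) = Y * (fps_deriv D * Y)"
  proof -
    have "fps_deriv D = 2 * Y * fps_deriv Y" unfolding Y2[symmetric] by (simp add: power2_eq_square)
    then show ?thesis unfolding Y2[symmetric] by (simp add: power2_eq_square algebra_simps)
  qed
  moreover have "Y \<noteq> 0"
  proof
    assume "Y = 0"
    then have "fps_nth Y 0 = 0" by simp
    then show False by (simp add: Y_def mult.assoc)
  qed
  ultimately have "2 * fps_deriv Y * D = fps_deriv D * Y" by simp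
  moreover have "fps_deriv D = 2 * (fps_const (c\<^sup>2) * fps_X - fps_const b)"
    unfolding D_def fps_numeral_fps_const
    by (simp add: power2_eq_square fps_const_add[symmetric] algebra_simps flip: fps_const_mult)
  ultimately have "2 * (fps_deriv Y * D) = 2 * ((fps_const (c\<^sup>2) * fps_X - fps_const b) * Y)"
    by (simp add: mult.assoc)
  then have "fps_deriv Y * D = (fps_const (c\<^sup>2) * fps_X - fps_const b) * Y" by simp
  then have eq: "fps_deriv Y - fps_const (2 * b) * (fps_X * fps_deriv Y)
        + fps_const (c\<^sup>2) * (fps_X * (fps_X * fps_deriv Y))
      = fps_const (c\<^sup>2) * (fps_X * Y) - fps_const b * Y"
    unfolding D_def by (simp add: algebra_simps power2_eq_square)
  \<comment> \<open>The indices start at 2 because the coefficient of \<open>Y\<close> at 1 also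
    contains \<open>-c\<close>.\<close>
  have Y_nth: "fps_nth Y (Suc (Suc n)) = - 2 * q * a (Suc n)" for n
    by (simp add: Y_def F_def mult.assoc)
  have 1: "(real m + 3) * (- 2 * q * a (m + 2)) - 2 * b * (real m + 2) * (- 2 * q * a (m + 1))
      + c\<^sup>2 * (real m + 1) * fps_nth Y (m + 1) = c\<^sup>2 * fps_nth Y (m + 1) - b * (- 2 * q * a (m + 1))"
  proof -
    have "fps_nth (fps_deriv Y) (m + 2) - 2 * b * fps_nth (fps_deriv Y) (m + 1) + c\<^sup>2 * fps_nth (fps_deriv Y) m
        = c\<^sup>2 * fps_nth Y (m + 1) - b * fps_nth Y (m + 2)"
      using arg_cong[OF eq, of "\<lambda>Z. fps_nth Z (m + 2)"] by simp
    then show ?thesis using Y_nth[of "Suc m"] Y_nth[of m] by (simp add: algebra_simps)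
  qed
  \<comment> \<open>The factor \<open>real m\<close> covers the exceptional coefficient at
    \<open>m = 0\<close>.\<close>
  have 2: "real m * fps_nth Y (m + 1) = real m * (- 2 * q * a m)"
    using Y_nth[of "m - 1"] by (cases m) auto
  have "(- 2 * q) * ((real m + 3) * a (m + 2)) =
    (- 2 * q) * (b * (2 * real m + 3) * a (m + 1) - c\<^sup>2 * real m * a m)"
    using 1 2 by algebra
  then show ?thesis using q unfolding b_def by (simp only: mult_cancel_left) simp
qed

text \<open>The triangle \<open>i + j < N\<close> lies inside the square of side
  \<open>N\<close>.\<close>

lemma sum_cauchy_prod_le:
  assumes "\<And>n. a n \<ge> 0"
  shows "(\<Sum>n<N. cauchy_prod a a n) \<le> (\<Sum>n<N. a n)\<^sup>2"
proof -
  have "(\<Sum>n<N. cauchy_prod a a n) = (\<Sum>(i,j)\<in>{(i,j). i + j < N}. a i * a j)"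
    unfolding cauchy_prod_def by (rule sum.triangle_reindex[symmetric])
  also have "\<dots> \<le> (\<Sum>(i,j)\<in>{..<N} \<times> {..<N}. a i * a j)"
    by (rule sum_mono2) (use assms in auto)
  also have "\<dots> = (\<Sum>n<N. a n)\<^sup>2"
    by (simp add: power2_eq_square sum_product sum.cartesian_product)
  finally show ?thesis .
qed

text \<open>The hypothesis \<open>(1 - c)\<^sup>2 = 4 q e\<close> says that the dominant singularity of the generating function,
  a zero of its discriminant, is at \<open>1\<close>.\<close>

lemma quadratic_class_subexponential:
  fixes a :: "nat \<Rightarrow> real"
  assumes a0: "a 0 = e" and rec: "\<And>n. a (Suc n) = c * a n + q * cauchy_prod a a n"
    and q: "q > 0" and e: "e > 0" and c: "0 \<le> c" "c < 1" and disc: "(1 - c)\<^sup>2 = 4 * q * e"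
  shows "subexponential a" and "suminf a = (1 - c) / (2 * q)"
proof -
  \<comment> \<open>The double root of \<open>e + c x + q x\<^sup>2 = x\<close>.\<close>
  define A where "A = (1 - c) / (2 * q)"
  have A: "e + c * A + q * A\<^sup>2 = A"
  proof -
    have "2 * q * A = 1 - c" using q by (simp add: A_def)
    then have "4 * q * (e + c * A + q * A\<^sup>2) = 4 * q * A" using disc by algebra
    then show ?thesis using q by simp
  qed
  have A0: "A \<ge> 0" using c q by (simp add: A_def)
  have pos: "a n > 0" for n
  proof (induction n rule: less_induct)
    case (less n)
    show ?case
    proof (cases n)
      case 0 then show ?thesis using a0 e by simp
    next
      case (Suc m)
      then have pos_le: "a k > 0" if "k \<le> m" for k using less that by simp
      then have "cauchy_prod a a m > 0"
        unfolding cauchy_prod_def by (intro sum_pos mult_pos_pos) auto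
      then have "q * cauchy_prod a a m > 0" using q by simp
      moreover have "c * a m \<ge> 0" using c(1) pos_le[of m] by simp
      ultimately show ?thesis using Suc rec[of m] by simp
    qed
  qed
  \<comment> \<open>The map \<open>x \<mapsto> e + c x + q x\<^sup>2\<close> is monotone on
    nonnegative numbers, fixes \<open>A\<close>, and bounds each partial sum in terms of the
    previous one.\<close>
  have partial: "(\<Sum>n<N. a n) \<le> A" for N
  proof (induction N)
    case (Suc N)
    have "(\<Sum>n<Suc N. a n) = e + c * (\<Sum>n<N. a n) + q * (\<Sum>n<N. cauchy_prod a a n)"
      by (simp only: sum.lessThan_Suc_shift) (simp add: a0 rec sum.distrib sum_distrib_left)
    also have "\<dots> \<le> e + c * A + q * A\<^sup>2"
    proof -
      have "(\<Sum>n<N. cauchy_prod a a n) \<le> (\<Sum>n<N. a n)\<^sup>2"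
        by (rule sum_cauchy_prod_le) (use pos in \<open>simp add: less_imp_le\<close>)
      also have "\<dots> \<le> A\<^sup>2" using Suc pos by (intro power_mono sum_nonneg) (auto simp: less_imp_le)
      finally show ?thesis using q c(1) Suc by (intro add_mono mult_left_mono) auto
    qed
    finally show ?case using A by simp
  qed (use A0 in simp)
  have sum: "summable a"
    by (rule summableI_nonneg_bounded[OF _ partial]) (use pos in \<open>simp add: less_imp_le\<close>)
  have suma: "suminf a = A"
  proof -
    have "summable (\<lambda>n. \<bar>a n\<bar>)" using sum pos by (simp add: less_imp_le)
    then have "(\<lambda>n. c * a n + q * cauchy_prod a a n) sums (c * suminf a + q * (suminf a * suminf a))"
      using sum by (intro sums_add sums_mult cauchy_prod_sums summable_sums)
    moreover have "(\<lambda>n. a (Suc n)) sums (suminf a - e)"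
      using summable_sums[OF sum] a0 by (simp add: sums_Suc_iff)
    ultimately have S: "suminf a - e = c * suminf a + q * (suminf a * suminf a)"
      unfolding rec using sums_unique2 by blast
    \<comment> \<open>By \<open>disc\<close> the equation for the sum is a perfect square, so it
      leaves only the value \<open>A\<close>.\<close>
    then have "4 * q * e = 2 * (1 - c) * (2 * q * suminf a) - (2 * q * suminf a)\<^sup>2" by algebra
    then have "(1 - c - 2 * q * suminf a)\<^sup>2 = 0" using disc by algebra
    then show ?thesis using q by (simp add: A_def field_simps)
  qed
  then show "suminf a = (1 - c) / (2 * q)" by (simp add: A_def)
  define b where "b = c + 2 * q * e"
  \<comment> \<open>With \<open>c < 1\<close> this puts \<open>b\<close> strictly between
    \<open>c\<^sup>2\<close> and 1, so that \<open>c\<^sup>2 / b\<close> can serve as a contraction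
    factor.\<close>
  have b: "2 * b = 1 + c\<^sup>2" using disc unfolding b_def by algebra
  have c2: "c\<^sup>2 < 1" using c by (simp add: power_less_one_iff)
  have b0: "b > 0" "c\<^sup>2 / b < 1" using b c2 zero_le_power2[of c] by (linarith, subst divide_less_eq_1) linarith
  define \<rho> where "\<rho> n = a (Suc n) / a n" for n
  have \<rho>_ge: "\<rho> n \<ge> b" if "n \<ge> 1" for n
  proof -
    \<comment> \<open>The two extreme terms of the convolution, distinct since
      \<open>n \<ge> 1\<close>, already give the lower bound.\<close>
    have "2 * e * a n = (\<Sum>k\<in>{0,n}. a k * a (n - k))" using that a0 by simp
    also have "\<dots> \<le> cauchy_prod a a n" unfolding cauchy_prod_def
      using pos by (intro sum_mono2) (auto simp: less_imp_le)
    finally have "q * (2 * e * a n) \<le> q * cauchy_prod a a n" using q by simp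
    then have "b * a n \<le> a (Suc n)" by (simp add: rec b_def algebra_simps)
    then show ?thesis using pos[of n] by (simp add: \<rho>_def field_simps)
  qed
  have \<rho>_rec: "(real m + 3) * \<rho> (Suc m) = b * (2 * real m + 3) - c\<^sup>2 * real m / \<rho> m" for m
    using quadratic_recurrence[of a e c q m, OF a0 rec] q pos[of m] pos[of "Suc m"]
    unfolding b_def by (simp add: \<rho>_def field_simps)
  define K where "K = 3 * b + 3 * c\<^sup>2 / b"
  \<comment> \<open>In the limit \<open>\<rho>_rec\<close> becomes iteration of
    \<open>x \<mapsto> 1 + c\<^sup>2 - c\<^sup>2 / x\<close>, with fixed points 1 and
    \<open>c\<^sup>2\<close>. The bound \<open>\<rho> m \<ge> b > c\<^sup>2\<close> keeps away from
    the second and makes the map contract towards 1; \<open>K / (real m + 3)\<close> is the error of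
    passing to the limit.\<close>
  have step: "\<bar>\<rho> (Suc m) - 1\<bar> \<le> K / (real m + 3) + c\<^sup>2 / b * \<bar>\<rho> m - 1\<bar>" if m: "m \<ge> 1" for m
  proof -
    have \<rho>0: "\<rho> m > 0" using \<rho>_ge[OF m] b0 by linarith
    have inv: "1 / \<rho> m \<le> 1 / b" using \<rho>_ge[OF m] b0 by (simp add: frac_le)
    have cancel: "x = X / N + Z" if "N * x = X + N * Z" "N \<noteq> 0" for x X Z N :: real
      using that by (simp add: divide_simps) (simp add: algebra_simps)
    have "(real m + 3) * (\<rho> (Suc m) - 1)
        = (- 3 * b + 3 * c\<^sup>2 * (1 / \<rho> m)) + (real m + 3) * (c\<^sup>2 - c\<^sup>2 * (1 / \<rho> m))"
      using \<rho>_rec[of m] b unfolding times_divide_eq_right mult_1_right by algebra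
    then have "\<rho> (Suc m) - 1
        = (- 3 * b + 3 * c\<^sup>2 * (1 / \<rho> m)) / (real m + 3) + (c\<^sup>2 - c\<^sup>2 * (1 / \<rho> m))"
      by (rule cancel) auto
    then have "\<rho> (Suc m) - 1
        = (- 3 * b + 3 * c\<^sup>2 * (1 / \<rho> m)) / (real m + 3) + c\<^sup>2 * (1 / \<rho> m) * (\<rho> m - 1)"
      using \<rho>0 by (simp add: right_diff_distrib)
    moreover have "\<bar>(- 3 * b + 3 * c\<^sup>2 * (1 / \<rho> m)) / (real m + 3)\<bar> \<le> K / (real m + 3)"
    proof -
      have "3 * c\<^sup>2 * (1 / \<rho> m) \<le> 3 * c\<^sup>2 * (1 / b)" using inv by (intro mult_left_mono) auto
      moreover have "3 * c\<^sup>2 * (1 / \<rho> m) \<ge> 0" using \<rho>0 by simp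
      moreover have "K = 3 * b + 3 * c\<^sup>2 * (1 / b)" by (simp add: K_def)
      ultimately have "\<bar>- 3 * b + 3 * c\<^sup>2 * (1 / \<rho> m)\<bar> \<le> K" using b0(1) by linarith
      then show ?thesis unfolding abs_divide by (simp add: divide_right_mono)
    qed
    moreover have "\<bar>c\<^sup>2 * (1 / \<rho> m) * (\<rho> m - 1)\<bar> \<le> c\<^sup>2 / b * \<bar>\<rho> m - 1\<bar>"
    proof -
      have "c\<^sup>2 * (1 / \<rho> m) \<le> c\<^sup>2 * (1 / b)" using inv by (intro mult_left_mono) auto
      then have "c\<^sup>2 * (1 / \<rho> m) * \<bar>\<rho> m - 1\<bar> \<le> c\<^sup>2 / b * \<bar>\<rho> m - 1\<bar>" by (intro mult_right_mono) auto
      then show ?thesis using \<rho>0 by (simp add: abs_mult)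
    qed
    ultimately show ?thesis by linarith
  qed
  have "(\<lambda>n. \<bar>\<rho> n - 1\<bar>) \<longlonglongrightarrow> 0"
  proof (rule tendsto_zero_contracting[where \<theta> = "(1 + c\<^sup>2 / b) / 2"])
    have "\<bar>\<rho> (Suc n) - 1\<bar> \<le> 2 * b + 1" for n
    proof -
      have "\<rho> n > 0" "\<rho> (Suc n) > 0" using pos by (auto simp: \<rho>_def)
      then have "(real n + 3) * \<rho> (Suc n) \<le> b * (2 * real n + 3)" by (simp add: \<rho>_rec)
      also have "\<dots> \<le> (real n + 3) * (2 * b)" using b0(1) by (simp add: algebra_simps)
      finally have "\<rho> (Suc n) \<le> 2 * b" by (subst (asm) mult_le_cancel_left_pos) auto
      then show ?thesis using \<open>\<rho> (Suc n) > 0\<close> b0(1) by linarith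
    qed
    then have "\<forall>\<^sub>F n in sequentially. \<bar>\<rho> (Suc n) - 1\<bar> \<le> 2 * b + 1" by simp
    then show "\<forall>\<^sub>F n in sequentially. \<bar>\<rho> n - 1\<bar> \<le> 2 * b + 1"
      by (rule iffD1[OF eventually_sequentially_Suc])
  next
    fix B :: real assume B: "B > 0" and ev: "\<forall>\<^sub>F n in sequentially. \<bar>\<rho> n - 1\<bar> \<le> B"
    have "(\<lambda>m. K / (real m + 3)) \<longlonglongrightarrow> 0" by real_asymp
    moreover have "0 < (1 - c\<^sup>2 / b) / 2 * B" using b0 B by simp
    ultimately have "\<forall>\<^sub>F m in sequentially. K / (real m + 3) < (1 - c\<^sup>2 / b) / 2 * B"
      by (rule order_tendstoD(2))
    then show "\<forall>\<^sub>F n in sequentially. \<bar>\<rho> (Suc n) - 1\<bar> \<le> (1 + c\<^sup>2 / b) / 2 * B"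
      using ev eventually_ge_at_top[of 1]
    proof eventually_elim
      case (elim m)
      have "c\<^sup>2 / b * \<bar>\<rho> m - 1\<bar> \<le> c\<^sup>2 / b * B" using elim(2) b0 by (intro mult_left_mono) auto
      moreover have "(1 - c\<^sup>2 / b) / 2 * B + c\<^sup>2 / b * B = (1 + c\<^sup>2 / b) / 2 * B"
        by (simp add: field_simps)
      ultimately show ?case using step[OF elim(3)] elim(1) by linarith
    qed
  qed (use b0 in auto)
  then have \<rho>l: "\<rho> \<longlonglongrightarrow> 1" by (simp add: tendsto_rabs_zero_iff LIM_zero_iff)
  show "subexponential a"
  proof
    show "(\<lambda>n. a (Suc n) / a n) \<longlonglongrightarrow> 1" using \<rho>l unfolding \<rho>_def .
    \<comment> \<open>Dividing \<open>rec\<close> by \<open>a n\<close> turns the limit of the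
      ratios into that of \<open>(a * a) / a\<close>.\<close>
    have "(\<lambda>n. (\<rho> n - c) / q) \<longlonglongrightarrow> (1 - c) / q" using q by (intro tendsto_intros \<rho>l) auto
    moreover have "(\<rho> n - c) / q = cauchy_prod a a n / a n" for n
    proof -
      have "\<rho> n = c + q * (cauchy_prod a a n / a n)" 
        using pos[of n] by (simp add: \<rho>_def rec field_simps)
      then show ?thesis using q by simp
    qed
    moreover have "(1 - c) / q = 2 * suminf a" using q by (simp add: suma A_def field_simps)
    ultimately show "(\<lambda>n. cauchy_prod a a n / a n) \<longlonglongrightarrow> 2 * suminf a" by simp
  qed (use pos sum in auto)
qed

section \<open>Counting formulas\<close>

lemma formulas_iff [simp]:
  "Prim i \<in> formulas p q s \<longleftrightarrow> i \<in> {1..s}"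
  "Una i A \<in> formulas p q s \<longleftrightarrow> i \<in> {1..p} \<and> A \<in> formulas p q s"
  "Bin j A B \<in> formulas p q s \<longleftrightarrow> j \<in> {1..q} \<and> A \<in> formulas p q s \<and> B \<in> formulas p q s"
  by (subst formulas.simps; auto)+

definition una_class :: "nat set \<Rightarrow> form set \<Rightarrow> form set" where
  "una_class I X = {Una i A | i A. i \<in> I \<and> A \<in> X}"

definition bin_class :: "nat set \<Rightarrow> form set \<Rightarrow> form set \<Rightarrow> form set" where
  "bin_class J X Y = {Bin j A B | j A B. j \<in> J \<and> A \<in> X \<and> B \<in> Y}"

lemma stratum_Un: "stratum p q s (X \<union> Y) n = stratum p q s X n \<union> stratum p q s Y n"
  by (auto simp: stratum_def)

lemma stratum_Diff: "stratum p q s (X - Y) n = stratum p q s X n - stratum p q s Y n"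
  by (auto simp: stratum_def)

lemma stratum_formulas: "stratum p q s W n \<subseteq> stratum p q s (formulas p q s) n"
  by (auto simp: stratum_def)

lemma stratum_Prim: "I \<subseteq> {1..s} \<Longrightarrow> stratum p q s (Prim ` I) n = (if n = 0 then Prim ` I else {})"
  by (auto simp: stratum_def)

lemma stratum_una_0 [simp]: "stratum p q s (una_class I X) 0 = {}"
  by (auto simp: stratum_def una_class_def)

lemma stratum_bin_0 [simp]: "stratum p q s (bin_class J X Y) 0 = {}"
  by (auto simp: stratum_def bin_class_def)

lemma stratum_una_Suc:
  assumes "I \<subseteq> {1..p}"
  shows "stratum p q s (una_class I X) (Suc n) = (\<lambda>(i, A). Una i A) ` (I \<times> stratum p q s X n)"
  using assms by (fastforce simp: stratum_def una_class_def)

text \<open>The outer connective leaves complexity \<open>n\<close> for both arguments. The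
  complexity \<open>k\<close> of the left one is carried in the tuple so that the cardinality of the
  index set is a convolution sum.\<close>

lemma stratum_bin_Suc:
  assumes "J \<subseteq> {1..q}"
  shows "stratum p q s (bin_class J X Y) (Suc n) = (\<lambda>(j, k, A, B). Bin j A B) `
    (J \<times> (SIGMA k:{..n}. stratum p q s X k \<times> stratum p q s Y (n - k)))" (is "?L = ?R")
proof (intro equalityI subsetI)
  fix x assume "x \<in> ?L"
  then obtain j A B where x: "x = Bin j A B" "j \<in> J" "A \<in> X" "B \<in> Y" "x \<in> formulas p q s"
    "complexity x = Suc n"
    by (auto simp: stratum_def bin_class_def)
  then have "(j, complexity A, A, B) \<in> J \<times> (SIGMA k:{..n}. stratum p q s X k \<times> stratum p q s Y (n - k))"
    by (auto simp: stratum_def)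
  then show "x \<in> ?R" unfolding x(1) by (metis (no_types, lifting) case_prod_conv image_eqI)
next
  fix x assume "x \<in> ?R"
  then show "x \<in> ?L" using assms by (auto simp: stratum_def bin_class_def)
qed

lemma formulas_unfold:
  "formulas p q s = Prim ` {1..s} \<union> (una_class {1..p} (formulas p q s)
    \<union> bin_class {1..q} (formulas p q s) (formulas p q s))" (is "?F = ?R")
proof -
  have "x \<in> ?F \<longleftrightarrow> x \<in> ?R" for x by (cases x) (auto simp: una_class_def bin_class_def)
  then show ?thesis by blast
qed

lemma finite_stratum [simp]: "finite (stratum p q s W n)"
proof (rule finite_subset[OF stratum_formulas])
  show "finite (stratum p q s (formulas p q s) n)"
  proof (induction n rule: less_induct)
    case (less n)
    show ?case
      by (subst formulas_unfold, cases n)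
        (auto simp: stratum_Un stratum_Prim stratum_una_Suc stratum_bin_Suc less
          intro!: finite_imageI finite_cartesian_product finite_SigmaI)
  qed
qed

lemma card_stratum_una:
  assumes "I \<subseteq> {1..p}"
  shows "card (stratum p q s (una_class I X) (Suc n)) = card I * card (stratum p q s X n)"
  unfolding stratum_una_Suc[OF assms]
  by (subst card_image) (auto simp: inj_on_def card_cartesian_product)

lemma card_stratum_bin:
  assumes "J \<subseteq> {1..q}"
  shows "card (stratum p q s (bin_class J X Y) (Suc n))
    = card J * (\<Sum>k\<le>n. card (stratum p q s X k) * card (stratum p q s Y (n - k)))"
proof -
  have "inj_on (\<lambda>(j, k, A, B). Bin j A B)
      (J \<times> (SIGMA k:{..n}. stratum p q s X k \<times> stratum p q s Y (n - k)))"
    by (auto simp: inj_on_def stratum_def)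
  then show ?thesis
    unfolding stratum_bin_Suc[OF assms] by (subst card_image) (auto simp: card_cartesian_product)
qed

text \<open>The exponent \<open>n + 1\<close> absorbs the outer connective of a binary formula:
  \<open>(k + 1) + (n - k + 1)\<close> is the exponent for complexity \<open>n + 1\<close>, so no
  power of the growth ratio is left in front of the convolution.\<close>

definition weight :: "nat \<Rightarrow> nat \<Rightarrow> nat \<Rightarrow> form set \<Rightarrow> nat \<Rightarrow> real" where
  "weight p q s W n = growth_ratio p q s ^ (n + 1) * real (card (stratum p q s W n))"

lemma lambda_of_weight: "lambda_of p q s W = suminf (weight p q s W)"
  by (simp add: lambda_of_def weight_def[abs_def])

lemma weight_Un:
  assumes "stratum p q s X n \<inter> stratum p q s Y n = {}"
  shows "weight p q s (X \<union> Y) n = weight p q s X n + weight p q s Y n"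
  using assms by (simp add: weight_def stratum_Un card_Un_disjoint distrib_left)

lemma weight_Diff:
  assumes "stratum p q s Y n \<subseteq> stratum p q s X n"
  shows "weight p q s (X - Y) n = weight p q s X n - weight p q s Y n"
  using assms card_mono[OF finite_stratum assms]
  by (simp add: weight_def stratum_Diff card_Diff_subset of_nat_diff right_diff_distrib)

lemma weight_Prim:
  assumes "I \<subseteq> {1..s}"
  shows "weight p q s (Prim ` I) n = (if n = 0 then growth_ratio p q s * card I else 0)"
  using assms by (simp add: weight_def stratum_Prim card_image inj_on_def)

lemma weight_una:
  assumes "I \<subseteq> {1..p}"
  shows "weight p q s (una_class I X) 0 = 0"
    "weight p q s (una_class I X) (Suc n) = card I * growth_ratio p q s * weight p q s X n"
  using assms by (simp_all add: weight_def card_stratum_una)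

lemma weight_bin:
  assumes "J \<subseteq> {1..q}"
  shows "weight p q s (bin_class J X Y) 0 = 0"
    "weight p q s (bin_class J X Y) (Suc n)
      = card J * cauchy_prod (weight p q s X) (weight p q s Y) n"
proof -
  have "growth_ratio p q s ^ (Suc n + 1) * (real x * real y)
      = growth_ratio p q s ^ (k + 1) * real x * (growth_ratio p q s ^ (n - k + 1) * real y)"
    if "k \<in> {..n}" for k x y
  proof -
    have "Suc n + 1 = (k + 1) + (n - k + 1)" using that by simp
    then show ?thesis by (simp only: power_add) (simp add: mult_ac)
  qed
  then show "weight p q s (bin_class J X Y) (Suc n)
      = card J * cauchy_prod (weight p q s X) (weight p q s Y) n"
    unfolding weight_def card_stratum_bin[OF assms] cauchy_prod_def of_nat_mult of_nat_sum
      mult.left_commute[of _ "real (card J)"] sum_distrib_left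
    by (intro sum.cong refl arg_cong[of _ _ "(*) (real (card J))"])
qed (simp add: weight_def)

text \<open>Formulas with different constructors differ. The first clause strips the unary part from
  a union, after which the second applies.\<close>

lemma disjoint_shapes:
  "stratum p q s (Prim ` I) n \<inter> stratum p q s (una_class K X \<union> Z) n
    = stratum p q s (Prim ` I) n \<inter> stratum p q s Z n"
  "stratum p q s (Prim ` I) n \<inter> stratum p q s (bin_class J Y Z) n = {}"
  "stratum p q s (una_class K X) n \<inter> stratum p q s (bin_class J Y Z) n = {}"
  by (auto simp: stratum_def una_class_def bin_class_def)

lemma cauchy_prod_linear:
  "cauchy_prod (\<lambda>n. x * u n + y * u' n) v n = x * cauchy_prod u v n + y * cauchy_prod u' v n"
  by (simp add: cauchy_prod_def sum.distrib sum_distrib_left algebra_simps)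

text \<open>A point mass at \<open>m\<close> acts as a shift by \<open>m\<close>; in this form unary
  productions enter the coefficient sequence \<open>h\<close> of
  \<open>implicit_class\<close>.\<close>

lemma cauchy_prod_delta:
  "cauchy_prod (\<lambda>n. if n = m then x else 0) v n = (if m \<le> n then x * v (n - m) else 0)"
proof -
  have "cauchy_prod (\<lambda>n. if n = m then x else 0) v n = (\<Sum>k\<le>n. if k = m then x * v (n - k) else 0)"
    unfolding cauchy_prod_def by (intro sum.cong) auto
  then show ?thesis by simp
qed

section \<open>The growth constant and the sequence of all formulas\<close>

locale alphabet =
  fixes p q s :: nat
  assumes q: "q \<ge> 1" and s: "s \<ge> 1"
begin

abbreviation r :: real where "r \<equiv> growth_ratio p q s"
abbreviation \<omega> :: "form set \<Rightarrow> nat \<Rightarrow> real" where "\<omega> \<equiv> weight p q s"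
abbreviation F :: "form set" where "F \<equiv> formulas p q s"

text \<open>\<open>1 / r\<close> is the larger root of \<open>(L - p)\<^sup>2 = 4 q s L\<close>;
  multiplied by \<open>r\<^sup>2\<close> this is the vanishing discriminant asked for by
  \<open>quadratic_class_subexponential\<close>.\<close>

lemma growth_ratio_props:
  shows "r > 0" "real p * r < 1" "(1 - real p * r)\<^sup>2 = 4 * real q * (r * real s)"
    "real p * r + 2 * real q * real s * r < 1"
proof -
  define x where "x = (real p + real q * real s) * (real q * real s)"
  define L where "L = real p + 2 * real q * real s + 2 * sqrt x"
  have qs: "real q * real s > 0" using q s by (intro mult_pos_pos) auto
  then have x0: "x > 0" unfolding x_def by (intro mult_pos_pos[OF add_nonneg_pos[OF _ qs] qs]) simp
  have rL: "r = 1 / L" by (simp add: growth_ratio_def L_def x_def)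
  have L: "L > real p + 2 * real q * real s" "L > 0"
    using real_sqrt_gt_zero[OF x0] qs unfolding L_def by linarith+
  show "r > 0" using L rL by simp
  show 1: "real p * r + 2 * real q * real s * r < 1"
    using L unfolding rL by (simp add: field_simps)
  have "2 * real q * real s * r > 0" using qs \<open>r > 0\<close> by simp
  then show "real p * r < 1" using 1 by simp
  have "(L - (real p + 2 * real q * real s))\<^sup>2 = 4 * x"
    using x0 by (simp add: L_def power_mult_distrib)
  then have "(L - real p)\<^sup>2 = 4 * real q * real s * L"
    unfolding x_def by algebra
  moreover have "L * r = 1" using L rL by simp
  ultimately show "(1 - real p * r)\<^sup>2 = 4 * real q * (r * real s)"
    by algebra
qed

lemma weight_formulas:
  "\<omega> F 0 = r * real s"
  "\<omega> F (Suc n) = real p * r * \<omega> F n + real q * cauchy_prod (\<omega> F) (\<omega> F) n"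
proof -
  have *: "\<omega> F n = \<omega> (Prim ` {1..s}) n + (\<omega> (una_class {1..p} F) n + \<omega> (bin_class {1..q} F F) n)" for n
    by (subst formulas_unfold, subst weight_Un, simp add: disjoint_shapes,
      subst weight_Un, simp_all add: disjoint_shapes)
  show "\<omega> F 0 = r * real s" by (subst *) (simp add: weight_Prim weight_una weight_bin)
  show "\<omega> F (Suc n) = real p * r * \<omega> F n + real q * cauchy_prod (\<omega> F) (\<omega> F) n"
    by (subst *) (simp add: weight_Prim weight_una weight_bin)
qed

lemma lambda_formulas: "suminf (\<omega> F) = (1 - real p * r) / (2 * real q)"
  and subexponential_formulas: "subexponential (\<omega> F)"
  using quadratic_class_subexponential[of "\<omega> F" "r * real s" "real p * r" "real q"]
    weight_formulas growth_ratio_props q s by auto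

sublocale subexponential "\<omega> F" by (rule subexponential_formulas)

lemma weight_nonneg [simp]: "\<omega> W n \<ge> 0"
  using growth_ratio_props(1) by (simp add: weight_def)

lemma weight_mono:
  assumes "stratum p q s X n \<subseteq> stratum p q s Y n"
  shows "\<omega> X n \<le> \<omega> Y n"
  using card_mono[OF finite_stratum assms] growth_ratio_props(1) by (simp add: weight_def)

lemma weight_le: "\<bar>\<omega> W n\<bar> \<le> 1 * \<omega> F n"
  using weight_mono[OF stratum_formulas, of W n] by simp

lemmas summable_weight = summable_dominated[OF weight_le]

lemma proportion_weight: "proportion p q s W n = \<omega> W n / \<omega> F n"
  using growth_ratio_props(1) by (simp add: proportion_def weight_def)

lemma mu_tendsto:
  assumes "mu_exists p q s W"
  shows "(\<lambda>n. \<omega> W n / \<omega> F n) \<longlonglongrightarrow> mu_of p q s W"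
  using assms unfolding mu_exists_def mu_of_def convergent_LIMSEQ_iff
  by (simp add: proportion_weight[abs_def])

lemma muI:
  assumes "(\<lambda>n. \<omega> W n / \<omega> F n) \<longlonglongrightarrow> \<mu>"
  shows "mu_exists p q s W" "mu_of p q s W = \<mu>"
  using assms unfolding mu_exists_def mu_of_def
  by (auto simp: proportion_weight[abs_def] convergent_def limI)

lemma tendsto_delta:
  "(\<lambda>n. (if n = m then x else 0) / \<omega> F n) \<longlonglongrightarrow> 0"
  by (rule tendsto_eventually, rule eventually_mono[OF eventually_gt_at_top[of m]]) auto

lemma delta_le: "\<bar>if n = m then x else 0\<bar> \<le> (\<bar>x\<bar> / \<omega> F m) * \<omega> F n"
  using pos[of n] pos[of m] by auto

section \<open>Densities for the four schemes of productions\<close>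

theorem disjoint_union:
  assumes W: "W = class_of {Given U, Given V}"
    and disj: "\<And>n. stratum p q s U n \<inter> stratum p q s V n = {}"
    and U: "mu_exists p q s U" and V: "mu_exists p q s V"
  shows "mu_exists p q s W" "lambda_of p q s W = lambda_of p q s U + lambda_of p q s V"
    "mu_of p q s W = mu_of p q s U + mu_of p q s V"
proof -
  have "W = U \<union> V" unfolding W by (subst class_of_unfold) auto
  then have w: "\<omega> W n = \<omega> U n + \<omega> V n" for n using weight_Un[OF disj] by simp
  show "lambda_of p q s W = lambda_of p q s U + lambda_of p q s V"
    unfolding lambda_of_weight w[abs_def] by (rule suminf_add[symmetric]) (rule summable_weight)+
  have "(\<lambda>n. \<omega> W n / \<omega> F n) \<longlonglongrightarrow> mu_of p q s U + mu_of p q s V"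
    unfolding w add_divide_distrib by (intro tendsto_add mu_tendsto U V)
  from muI[OF this] show "mu_exists p q s W" "mu_of p q s W = mu_of p q s U + mu_of p q s V" by auto
qed

text \<open>All letters on the right are given, so the weights at \<open>n + 1\<close> are an
  explicit combination of weights and a convolution: summation gives the series,
  \<open>cauchy_prod_tendsto\<close> the density.\<close>

theorem explicit_class:
  assumes bounds: "p' \<le> p" "q' \<le> q" "s' \<le> s"
    and W: "W = class_of ({PPrim i | i. i \<in> {1..s'}} \<union> {PUna i (Given T) | i. i \<in> {1..p'}}
              \<union> {PBin j (Given U) (Given V) | j. j \<in> {1..q'}})"
    and T: "mu_exists p q s T" and U: "mu_exists p q s U" and V: "mu_exists p q s V"
  shows "mu_exists p q s W"
    "lambda_of p q s W = r * real s' + real p' * r * lambda_of p q s T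
      + real q' * lambda_of p q s U * lambda_of p q s V"
    "mu_of p q s W = real p' * r * mu_of p q s T
      + real q' * lambda_of p q s V * mu_of p q s U + real q' * lambda_of p q s U * mu_of p q s V"
proof -
  have W': "W = Prim ` {1..s'} \<union> (una_class {1..p'} T \<union> bin_class {1..q'} U V)"
    unfolding W Setcompr_eq_image
    by (subst class_of_unfold) (auto simp: una_class_def bin_class_def)
  have *: "\<omega> W n = \<omega> (Prim ` {1..s'}) n + (\<omega> (una_class {1..p'} T) n + \<omega> (bin_class {1..q'} U V) n)" for n
    unfolding W' by (subst weight_Un, simp add: disjoint_shapes,
      subst weight_Un, simp_all add: disjoint_shapes)
  have w0: "\<omega> W 0 = r * real s'" using bounds by (simp add: * weight_Prim weight_una weight_bin)
  have w: "\<omega> W (Suc n) = real p' * r * \<omega> T n + real q' * cauchy_prod (\<omega> U) (\<omega> V) n" for n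
    using bounds by (simp add: * weight_Prim weight_una weight_bin)
  have "(\<lambda>n. \<omega> W (Suc n)) sums (real p' * r * lambda_of p q s T
      + real q' * (lambda_of p q s U * lambda_of p q s V))"
    unfolding w lambda_of_weight
    by (intro sums_add sums_mult cauchy_prod_sums summable_sums summable_weight)
  then have "\<omega> W sums (real p' * r * lambda_of p q s T
      + real q' * (lambda_of p q s U * lambda_of p q s V) + \<omega> W 0)"
    by (simp add: sums_Suc_iff)
  then show "lambda_of p q s W = r * real s' + real p' * r * lambda_of p q s T
      + real q' * lambda_of p q s U * lambda_of p q s V"
    unfolding lambda_of_weight[of p q s W] by (simp add: w0 sums_unique[symmetric] mult.assoc)
  have "(\<lambda>n. (real p' * r * (\<omega> T n / \<omega> F n) + real q' * (cauchy_prod (\<omega> U) (\<omega> V) n / \<omega> F n))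
      * (\<omega> F n / \<omega> F (Suc n))) \<longlonglongrightarrow> (real p' * r * mu_of p q s T
      + real q' * (lambda_of p q s U * mu_of p q s V + lambda_of p q s V * mu_of p q s U)) * 1"
    unfolding lambda_of_weight
    by (intro tendsto_intros mu_tendsto T ratio_inverse
          cauchy_prod_tendsto[OF weight_le weight_le] U V)
  moreover have "(real p' * r * (\<omega> T n / \<omega> F n) + real q' * (cauchy_prod (\<omega> U) (\<omega> V) n / \<omega> F n))
      * (\<omega> F n / \<omega> F (Suc n)) = \<omega> W (Suc n) / \<omega> F (Suc n)" for n
    unfolding w by (simp add: field_simps)
  ultimately have "(\<lambda>n. \<omega> W (Suc n) / \<omega> F (Suc n)) \<longlonglongrightarrow> real p' * r * mu_of p q s T
      + real q' * lambda_of p q s V * mu_of p q s U + real q' * lambda_of p q s U * mu_of p q s V"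
    by (simp add: algebra_simps)
  then have "(\<lambda>n. \<omega> W n / \<omega> F n) \<longlonglongrightarrow> real p' * r * mu_of p q s T
      + real q' * lambda_of p q s V * mu_of p q s U + real q' * lambda_of p q s U * mu_of p q s V"
    by (rule LIMSEQ_imp_Suc)
  from muI[OF this] show "mu_exists p q s W" "mu_of p q s W = real p' * r * mu_of p q s T
      + real q' * lambda_of p q s V * mu_of p q s U + real q' * lambda_of p q s U * mu_of p q s V"
    by auto
qed

text \<open>The case \<open>d = 0\<close> of \<open>implicit_class\<close>, with \<open>h\<close>
  supported on 0 and 1. The bounds of \<open>q'\<close> by \<open>p\<close> and \<open>s\<close>
  keep the symbols of the mixed productions inside the alphabet.\<close>

theorem linear_class:
  assumes bounds: "p' \<le> p" "q' \<le> q" "q' \<le> p" "q' \<le> s"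
    and G: "G = {PUna i Self | i. i \<in> {1..p'}}
            \<union> {PBin j (PPrim j) (PUna j Self) | j. j \<in> {1..q'}}"
    and W: "W = class_of (insert (Given U) G)"
    and disj: "no_other p q s U W G" and U: "mu_exists p q s U"
  shows "mu_exists p q s W"
    "lambda_of p q s W = lambda_of p q s U / (1 - real p' * r - real q' * r\<^sup>2)"
    "mu_of p q s W = mu_of p q s U / (1 - real p' * r - real q' * r\<^sup>2)"
proof -
  define Z where "Z = {Bin j (Prim j) (Una j A) | j A. j \<in> {1..q'} \<and> A \<in> W}"
  have G': "(\<Union>P\<in>G. instances W P) = una_class {1..p'} W \<union> Z"
    unfolding G Z_def una_class_def Setcompr_eq_image by auto
  have "W = (\<Union>P\<in>insert (Given U) G. instances W P)"
    unfolding W by (rule class_of_unfold) (auto simp: G)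
  then have W': "W = U \<union> (una_class {1..p'} W \<union> Z)" using G' by simp
  have *: "\<omega> W n = \<omega> U n + (\<omega> (una_class {1..p'} W) n + \<omega> Z n)" for n
  proof -
    have "\<omega> W n = \<omega> U n + \<omega> (una_class {1..p'} W \<union> Z) n"
      by (subst W', rule weight_Un) (use disj G' in \<open>simp add: no_other_def\<close>)
    also have "\<omega> (una_class {1..p'} W \<union> Z) n = \<omega> (una_class {1..p'} W) n + \<omega> Z n"
      by (rule weight_Un) (auto simp: stratum_def una_class_def Z_def)
    finally show ?thesis .
  qed
  have Z0: "\<omega> Z 0 = 0" "\<omega> Z (Suc 0) = 0" 
  proof -
    have "stratum p q s Z 0 = {}" "stratum p q s Z (Suc 0) = {}" by (auto simp: stratum_def Z_def)
    then show "\<omega> Z 0 = 0" "\<omega> Z (Suc 0) = 0" by (simp_all add: weight_def)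
  qed
  \<comment> \<open>The mixed productions add two connectives, hence the factor
    \<open>r\<^sup>2\<close> and the shift by two.\<close>
  have Z: "\<omega> Z (Suc (Suc n)) = real q' * r\<^sup>2 * \<omega> W n" for n
  proof -
    have "stratum p q s Z (Suc (Suc n))
        = (\<lambda>(j, A). Bin j (Prim j) (Una j A)) ` ({1..q'} \<times> stratum p q s W n)"
      using bounds by (fastforce simp: stratum_def Z_def)
    then have "card (stratum p q s Z (Suc (Suc n))) = q' * card (stratum p q s W n)"
      by (simp add: card_image inj_on_def card_cartesian_product)
    then show ?thesis by (simp add: weight_def power2_eq_square)
  qed
  \<comment> \<open>The factors 1 give \<open>h\<close> the shape to which
    \<open>cauchy_prod_linear\<close> applies.\<close>
  define h where "h = (\<lambda>n::nat. 1 * (if n = 0 then real p' * r else 0) + 1 * (if n = 1 then real q' * r\<^sup>2 else 0))"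
  \<comment> \<open>From \<open>q' \<le> p\<close> and \<open>p r < 1\<close> follows
    \<open>q' r\<^sup>2 \<le> r \<le> 2 q s r\<close>, and \<open>p r + 2 q s r < 1\<close>.\<close>
  have r1: "real p' * r + real q' * r\<^sup>2 < 1"
  proof -
    have "real p' * r \<le> real p * r" using bounds growth_ratio_props(1) by simp
    moreover have "real q' * r\<^sup>2 \<le> (real p * r) * r"
      using bounds growth_ratio_props(1) by (simp add: power2_eq_square)
    moreover have "(real p * r) * r \<le> 1 * r" using growth_ratio_props by (intro mult_right_mono) auto
    moreover have "1 * r \<le> (2 * real q * real s) * r"
    proof (rule mult_right_mono)
      have "1 * 1 \<le> real q * real s" using q s by (intro mult_mono) auto
      then show "1 \<le> 2 * real q * real s" by simp
    qed (use growth_ratio_props(1) in simp)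
    ultimately show ?thesis using growth_ratio_props(4) by linarith
  qed
  have hsum: "suminf h = real p' * r + real q' * r\<^sup>2" "(\<Sum>k. \<bar>h k\<bar>) = real p' * r + real q' * r\<^sup>2"
    using growth_ratio_props(1)
    by (subst suminf_finite[of "{0, 1}"]; auto simp: h_def)+
  have hl: "(\<lambda>n. h n / \<omega> F n) \<longlonglongrightarrow> 1 * 0 + 1 * 0"
    unfolding h_def add_divide_distrib times_divide_eq_right[symmetric]
    by (intro tendsto_intros tendsto_delta)
  have hb: "\<bar>h n\<bar> \<le> (\<bar>real p' * r\<bar> / \<omega> F 0 + \<bar>real q' * r\<^sup>2\<bar> / \<omega> F 1) * \<omega> F n" for n
    unfolding h_def distrib_right mult_1
    by (rule order_trans[OF abs_triangle_ineq]) (intro add_mono delta_le)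
  have rec: "\<omega> W (Suc n) = \<omega> U (Suc n) + cauchy_prod h (\<omega> W) n + 0 * cauchy_prod (\<omega> W) (\<omega> W) n" for n
    unfolding h_def cauchy_prod_linear cauchy_prod_delta *
    using bounds by (cases n) (simp_all add: weight_una Z Z0 *)
  have base: "\<omega> W 0 = \<omega> U 0" using bounds by (simp add: * weight_una Z0)
  note impl = implicit_class[OF rec base weight_le hb weight_le mu_tendsto[OF U] hl]
  have "lambda_of p q s W = lambda_of p q s U + suminf h * lambda_of p q s W"
    using impl(1) hsum r1 by (simp add: lambda_of_weight)
  then show "lambda_of p q s W = lambda_of p q s U / (1 - real p' * r - real q' * r\<^sup>2)"
    using r1 by (simp add: hsum field_simps)
  have "(\<lambda>n. \<omega> W n / \<omega> F n) \<longlonglongrightarrow> mu_of p q s U / (1 - real p' * r - real q' * r\<^sup>2)"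
    using impl(3) hsum r1 by (simp add: diff_diff_eq)
  from muI[OF this] show "mu_exists p q s W"
    "mu_of p q s W = mu_of p q s U / (1 - real p' * r - real q' * r\<^sup>2)" by auto
qed

text \<open>As \<open>W\<close> lies in \<open>V\<close>, the class \<open>V - W\<close> has weights
  \<open>v - w\<close>. Its productions add \<open>q''\<close> times \<open>v * w\<close> and remove
  \<open>q''\<close> times \<open>w * w\<close>, which puts \<open>q'' v\<close> into
  \<open>h\<close> and leaves the coefficient \<open>d\<close> in front of the square.\<close>

theorem quadratic_class:
  assumes bounds: "p' \<le> p" "q' \<le> q" "q'' \<le> q" "(p', q', q'') \<noteq> (p, q, 0)"
    and G: "G = {PUna i Self | i. i \<in> {1..p'}} \<union> {PBin j Self Self | j. j \<in> {1..q'}}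
            \<union> {PBin j (Minus_Self V) Self | j. j \<in> {1..q''}}"
    and W: "W = class_of (insert (Given U) G)"
    and disj: "no_other p q s U W G"
    and prim: "\<exists>i\<in>{1..s}. Prim i \<in> stratum p q s U 0"
    and sub: "\<And>n. stratum p q s W n \<subseteq> stratum p q s V n"
    and U: "mu_exists p q s U" and V: "mu_exists p q s V"
  defines "b \<equiv> 1 - real p' * r - real q'' * lambda_of p q s V"
    and "d \<equiv> real q' - real q''"
  shows "mu_exists p q s W"
    "lambda_of p q s W = 2 * lambda_of p q s U / (b + sqrt (b\<^sup>2 - 4 * d * lambda_of p q s U))"
    "mu_of p q s W = (mu_of p q s U + real q'' * lambda_of p q s W * mu_of p q s V)
      / (b - 2 * d * lambda_of p q s W)"
proof -
  have G': "(\<Union>P\<in>G. instances W P)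
      = una_class {1..p'} W \<union> (bin_class {1..q'} W W \<union> bin_class {1..q''} (V - W) W)"
    unfolding G una_class_def bin_class_def Setcompr_eq_image by auto
  have "W = (\<Union>P\<in>insert (Given U) G. instances W P)"
    unfolding W by (rule class_of_unfold) (auto simp: G)
  then have W': "W = U \<union> (una_class {1..p'} W \<union> (bin_class {1..q'} W W \<union> bin_class {1..q''} (V - W) W))"
    using G' by simp
  have *: "\<omega> W n = \<omega> U n + (\<omega> (una_class {1..p'} W) n
      + (\<omega> (bin_class {1..q'} W W) n + \<omega> (bin_class {1..q''} (V - W) W) n))" for n
  proof -
    let ?B = "bin_class {1..q'} W W" and ?B' = "bin_class {1..q''} (V - W) W"
    have "\<omega> W n = \<omega> U n + \<omega> (una_class {1..p'} W \<union> (?B \<union> ?B')) n"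
      by (subst W', rule weight_Un) (use disj G' in \<open>simp add: no_other_def\<close>)
    also have "\<omega> (una_class {1..p'} W \<union> (?B \<union> ?B')) n = \<omega> (una_class {1..p'} W) n + \<omega> (?B \<union> ?B') n"
      by (rule weight_Un) (auto simp: stratum_def una_class_def bin_class_def)
    also have "\<omega> (?B \<union> ?B') n = \<omega> ?B n + \<omega> ?B' n"
      by (rule weight_Un) (auto simp: stratum_def bin_class_def)
    finally show ?thesis .
  qed
  define h where "h = (\<lambda>n. real q'' * \<omega> V n + 1 * (if n = 0 then real p' * r else 0))"
  have VW: "cauchy_prod (\<omega> (V - W)) (\<omega> W) n = cauchy_prod (\<omega> V) (\<omega> W) n - cauchy_prod (\<omega> W) (\<omega> W) n" for n
    unfolding cauchy_prod_def sum_subtractf[symmetric]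
    by (simp add: weight_Diff[OF sub] left_diff_distrib)
  have rec: "\<omega> W (Suc n) = \<omega> U (Suc n) + cauchy_prod h (\<omega> W) n + d * cauchy_prod (\<omega> W) (\<omega> W) n" for n
    unfolding h_def cauchy_prod_linear cauchy_prod_delta *[of "Suc n"]
    using bounds by (simp add: weight_una weight_bin VW d_def algebra_simps)
  have base: "\<omega> W 0 = \<omega> U 0" using bounds by (simp add: * weight_una weight_bin)
  have hl: "(\<lambda>n. h n / \<omega> F n) \<longlonglongrightarrow> real q'' * mu_of p q s V + 1 * 0"
    unfolding h_def add_divide_distrib times_divide_eq_right[symmetric]
    by (intro tendsto_intros tendsto_delta mu_tendsto V)
  have hb: "\<bar>h n\<bar> \<le> (real q'' + \<bar>real p' * r\<bar> / \<omega> F 0) * \<omega> F n" for n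
    unfolding h_def distrib_right mult_1
    by (rule order_trans[OF abs_triangle_ineq], intro add_mono delta_le)
      (use weight_le[of V n] in \<open>simp add: mult_left_mono\<close>)
  have delta_sums: "(\<lambda>n::nat. if n = 0 then real p' * r else 0) sums (real p' * r)"
    using sums_single[of 0 "\<lambda>_. real p' * r"] by (simp add: eq_commute)
  have "h sums (real q'' * lambda_of p q s V + 1 * (real p' * r))"
    unfolding h_def lambda_of_weight
    by (intro sums_add sums_mult delta_sums summable_sums summable_weight)
  then have H: "suminf h = real q'' * lambda_of p q s V + real p' * r"
    by (simp add: sums_unique[symmetric])
  text \<open>Since \<open>0 \<le> w \<le> v \<le> a\<close>, the coefficients \<open>q'' v + 2 d w\<close> are at most \<open>K a\<close> in absolute value
    with \<open>K \<le> 2 q\<close>, and equality together with \<open>p' = p\<close> would mean \<open>(p', q', q'') = (p, q, 0)\<close>.\<close>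
  define K where "K = (if q'' \<le> q' then 2 * real q' - real q'' else real q'')"
  have le: "\<bar>h n + 2 * d * \<omega> W n\<bar> \<le> K * \<omega> F n + (if n = 0 then real p' * r else 0)" for n
  proof -
    have 0: "0 \<le> \<omega> W n" "\<omega> W n \<le> \<omega> V n" "\<omega> V n \<le> \<omega> F n"
      using weight_mono[OF sub] weight_mono[OF stratum_formulas] by auto
    have "\<bar>real q'' * \<omega> V n + 2 * d * \<omega> W n\<bar> \<le> K * \<omega> F n"
    proof (cases "q'' \<le> q'")
      case True
      have "real q'' * \<omega> V n \<le> real q'' * \<omega> F n" using 0 by (intro mult_left_mono) auto
      moreover have "2 * d * \<omega> W n \<le> 2 * d * \<omega> F n" using 0 True by (intro mult_left_mono) (auto simp: d_def)
      moreover have "0 \<le> real q'' * \<omega> V n" "0 \<le> 2 * d * \<omega> W n" using 0 True by (auto simp: d_def)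
      moreover have "K * \<omega> F n = real q'' * \<omega> F n + 2 * d * \<omega> F n"
        using True by (simp add: K_def d_def algebra_simps)
      ultimately show ?thesis by linarith
    next
      case False
      \<comment> \<open>Here \<open>d < 0\<close>; the lower bound comes from
        \<open>w \<le> v\<close>, as
        \<open>q'' v + 2 d w \<ge> q'' v - 2 q'' w \<ge> - q'' v\<close>.\<close>
      have "real q'' * \<omega> V n \<le> real q'' * \<omega> F n" "real q'' * \<omega> W n \<le> real q'' * \<omega> V n"
        using 0 by (auto intro!: mult_left_mono)
      moreover have "d * \<omega> W n \<le> 0" using 0 False by (auto simp: d_def intro!: mult_nonpos_nonneg)
      moreover have "d * \<omega> W n = real q' * \<omega> W n - real q'' * \<omega> W n" by (simp add: d_def algebra_simps)
      moreover have "0 \<le> real q' * \<omega> W n" using 0 by simp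
      moreover have "K * \<omega> F n = real q'' * \<omega> F n" using False by (simp add: K_def)
      moreover have "2 * d * \<omega> W n = 2 * (d * \<omega> W n)" by simp
      ultimately show ?thesis by linarith
    qed
    moreover have "0 \<le> real p' * r" using growth_ratio_props(1) by simp
    ultimately show ?thesis unfolding h_def by auto
  qed
  have "(\<lambda>n. K * \<omega> F n + (if n = 0 then real p' * r else 0)) sums (K * suminf (\<omega> F) + real p' * r)"
    by (intro sums_add sums_mult delta_sums summable_sums summable_weight)
  then have dom: "summable (\<lambda>n. K * \<omega> F n + (if n = 0 then real p' * r else 0))"
      "(\<Sum>n. K * \<omega> F n + (if n = 0 then real p' * r else 0)) = K * suminf (\<omega> F) + real p' * r"
    by (auto simp: sums_iff)
  have "(\<Sum>n. \<bar>h n + 2 * d * \<omega> W n\<bar>) \<le> K * suminf (\<omega> F) + real p' * r"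
    unfolding dom(2)[symmetric]
    by (intro suminf_le le dom(1) summable_comparison_test[OF _ dom(1)]) (use le in auto)
  also have "K * suminf (\<omega> F) + real p' * r < 1"
  proof -
    define A where "A = suminf (\<omega> F)"
    have A: "A > 0" "2 * real q * A + real p * r = 1"
      unfolding A_def lambda_formulas using q growth_ratio_props(2) by auto
    have "real p' * r \<le> real p * r" using bounds growth_ratio_props(1) by simp
    have K: "K \<le> 2 * real q" using bounds by (auto simp: K_def)
    show ?thesis unfolding A_def[symmetric]
    proof (cases "K = 2 * real q")
      case True
      then have "q' = q" "q'' = 0" using bounds q by (auto simp: K_def split: if_splits)
      then have "real p' < real p" using bounds by auto
      then have "real p' * r < real p * r" using growth_ratio_props(1) by simp
      then show "K * A + real p' * r < 1" using A True by simp
    next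
      case False
      then have "K * A < 2 * real q * A" using K A by simp
      then show "K * A + real p' * r < 1" using A(2) \<open>real p' * r \<le> real p * r\<close> by linarith
    qed
  qed
  finally have c: "(\<Sum>n. \<bar>h n + 2 * d * \<omega> W n\<bar>) < 1" .
  note impl = implicit_class[OF rec base weight_le hb weight_le mu_tendsto[OF U] hl c,
      folded lambda_of_weight, unfolded H]
  let ?U = "lambda_of p q s U" and ?W = "lambda_of p q s W"
  have pos: "b - 2 * d * ?W > 0" using impl(2) by (simp add: b_def)
  have eq: "?U = ?W * (b - d * ?W)"
    using impl(1) by (simp add: b_def power2_eq_square algebra_simps)
  \<comment> \<open>Positivity of the series of \<open>U\<close> excludes
    \<open>b - d * ?W = 0\<close> in the equation just derived.\<close>
  have "?U > 0"
  proof -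
    have "card (stratum p q s U 0) > 0" using prim by (auto simp: card_gt_0_iff)
    then have "\<omega> U 0 > 0" using growth_ratio_props(1) by (simp add: weight_def)
    then show ?thesis unfolding lambda_of_weight
      by (intro suminf_pos2[of _ 0] summable_weight) auto
  qed
  then have nz: "b - d * ?W \<noteq> 0" using eq by auto
  \<comment> \<open>The discriminant is the square of \<open>b - 2 * d * ?W\<close>, whose
    positivity, provided by \<open>implicit_class\<close>, selects the root. Writing the root with
    the square root in the denominator keeps the formula valid for \<open>d = 0\<close>.\<close>
  have "b\<^sup>2 - 4 * d * ?U = (b - 2 * d * ?W)\<^sup>2" using eq by algebra
  then have "sqrt (b\<^sup>2 - 4 * d * ?U) = b - 2 * d * ?W" using pos by simp
  then have "b + sqrt (b\<^sup>2 - 4 * d * ?U) = 2 * (b - d * ?W)" by simp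
  moreover have "2 * ?U / (2 * (b - d * ?W)) = ?W" 
    using nz eq by (metis nonzero_mult_div_cancel_right mult_divide_mult_cancel_left zero_neq_numeral)
  ultimately show "?W = 2 * ?U / (b + sqrt (b\<^sup>2 - 4 * d * ?U))" by simp
  have denom: "1 - (real q'' * lambda_of p q s V + real p' * r) - 2 * d * ?W = b - 2 * d * ?W"
    by (simp add: b_def)
  have num: "mu_of p q s U + (real q'' * mu_of p q s V + 1 * 0) * ?W
      = mu_of p q s U + real q'' * ?W * mu_of p q s V" by simp
  have "(\<lambda>n. \<omega> W n / \<omega> F n) \<longlonglongrightarrow> (mu_of p q s U + real q'' * ?W * mu_of p q s V)
      / (b - 2 * d * ?W)"
    using impl(3) unfolding denom num .
  from muI[OF this] show "mu_exists p q s W"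
    "mu_of p q s W = (mu_of p q s U + real q'' * ?W * mu_of p q s V) / (b - 2 * d * ?W)" by auto
qed

end

theorem theorem1:
  fixes p q s :: nat
  assumes "q \<ge> 1" and "s \<ge> 1"
  shows
    "(\<forall>U V W.
        U \<subseteq> formulas p q s \<and> V \<subseteq> formulas p q s \<and>
        W = class_of {Given U, Given V} \<and>
        (\<forall>n. stratum p q s U n \<inter> stratum p q s V n = {}) \<and>
        mu_exists p q s U \<and> mu_exists p q s V \<longrightarrow>
        mu_exists p q s W \<and>
        lambda_of p q s W = lambda_of p q s U + lambda_of p q s V \<and>
        mu_of p q s W = mu_of p q s U + mu_of p q s V)
   \<and> (\<forall>U V W p' q' q'' G.
        U \<subseteq> formulas p q s \<and> V \<subseteq> formulas p q s \<and>
        p' \<le> p \<and> q' \<le> q \<and> q'' \<le> q \<and> (p', q', q'') \<noteq> (p, q, 0) \<and>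
        G = {PUna i Self | i. i \<in> {1..p'}} \<union> {PBin j Self Self | j. j \<in> {1..q'}}
            \<union> {PBin j (Minus_Self V) Self | j. j \<in> {1..q''}} \<and>
        W = class_of (insert (Given U) G) \<and>
        no_other p q s U W G \<and>
        (\<exists>i\<in>{1..s}. Prim i \<in> stratum p q s U 0) \<and>
        (\<forall>n. stratum p q s W n \<subseteq> stratum p q s V n) \<and>
        mu_exists p q s U \<and> mu_exists p q s V \<longrightarrow>
        mu_exists p q s W \<and>
        (let r = growth_ratio p q s;
             lU = lambda_of p q s U; lV = lambda_of p q s V; lW = lambda_of p q s W;
             b = 1 - real p' * r - real q'' * lV;
             d = real q' - real q''
         in lW = 2 * lU / (b + sqrt (b\<^sup>2 - 4 * d * lU)) \<and>
            mu_of p q s W =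
              (mu_of p q s U + real q'' * lW * mu_of p q s V) / (b - 2 * d * lW)))
   \<and> (\<forall>T U V W p' q' s'.
        T \<subseteq> formulas p q s \<and> U \<subseteq> formulas p q s \<and> V \<subseteq> formulas p q s \<and>
        p' \<le> p \<and> q' \<le> q \<and> s' \<le> s \<and>
        W = class_of ({PPrim i | i. i \<in> {1..s'}} \<union> {PUna i (Given T) | i. i \<in> {1..p'}}
              \<union> {PBin j (Given U) (Given V) | j. j \<in> {1..q'}}) \<and>
        mu_exists p q s T \<and> mu_exists p q s U \<and> mu_exists p q s V \<longrightarrow>
        mu_exists p q s W \<and>
        (let r = growth_ratio p q s;
             lT = lambda_of p q s T; lU = lambda_of p q s U; lV = lambda_of p q s V
         in lambda_of p q s W = r * real s' + real p' * r * lT + real q' * lU * lV \<and>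
            mu_of p q s W = real p' * r * mu_of p q s T
              + real q' * lV * mu_of p q s U + real q' * lU * mu_of p q s V))
   \<and> (\<forall>U W p' q' G.
        U \<subseteq> formulas p q s \<and>
        p' \<le> p \<and> q' \<le> q \<and> q' \<le> p \<and> q' \<le> s \<and>
        G = {PUna i Self | i. i \<in> {1..p'}}
            \<union> {PBin j (PPrim j) (PUna j Self) | j. j \<in> {1..q'}} \<and>
        W = class_of (insert (Given U) G) \<and>
        no_other p q s U W G \<and>
        mu_exists p q s U \<longrightarrow>
        mu_exists p q s W \<and>
        (let r = growth_ratio p q s
         in lambda_of p q s W = lambda_of p q s U / (1 - real p' * r - real q' * r\<^sup>2) \<and>
            mu_of p q s W = mu_of p q s U / (1 - real p' * r - real q' * r\<^sup>2)))"
proof -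
  interpret alphabet p q s using assms by unfold_locales
  show ?thesis
    unfolding Let_def
    by (intro conjI allI impI; elim conjE;
      rule disjoint_union quadratic_class explicit_class linear_class; (assumption | erule spec))
qed

end
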